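(* Let $A\in\mathbb{R}^{n\times n}$ and $c\in\mathbb{R}^{1\times n}$ be such that $(A,c)$ is observable, and let $k\in\{1,\dots,n\}$. For $r\in\{1,\dots,k\}$ and $\beta\in\mathcal{I}_{n,k}$ define $P_\beta := I_{\{1,\dots,n\},\beta}\in\mathbb{R}^{n\times k}$ (the columns of the identity matrix $I\in\mathbb{R}^{n\times n}$ with indices in $\beta$), $\tilde A_r := A_{[r]}$, $\tilde c_r := \left(\mathcal{O}^r\right)_{[r]}$ and $$\tilde b_{k,r,\beta} := \begin{pmatrix}\left(A^{k-r}\left(\mathcal{O}^n\right)^{-1}\begin{pmatrix}0\\ I_{n-k+r}\end{pmatrix}\right)_{[r]} & 0\end{pmatrix}\left(\mathcal{O}^nP_\beta\right)_{[k]},$$ where the zero block has $\binom{n}{k}-\binom{n-k+r}{r}$ columns. (a) For all $r\in\{1,\dots,k\}$, $\beta\in\mathcal{I}_{n,k}$, all integers $N\ge1$ and $t\in\{1,\dots,N-k+1\}$, with $\alpha=\{1,\dots,k-r\}\cup\{k-r+t,\dots,k+t-1\}$, it holds that $$\det\left(\mathcal{O}^N_{\alpha,\beta}\right)=\tilde c_r\tilde A_r^{t-1}\tilde b_{k,r,\beta}.$$ (b) Therefore, the observability operator $\mathcal{O}$ of $(A,c)$ is $(k-1)$-variation bounding if the systems $(\tilde A_r,\tilde b_{k,r,\beta},\tilde c_r)$, for all $(r,\beta)$ with $r\in\{1,\dots,k\}$ and $\beta=\{1,\dots,k-\bar r\}\cup\{\bar t,\dots,\bar t+\bar r-1\}$,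 where $\bar r\in\{1,\dots,k\}$ and $\bar t\in\{k-\bar r+1,\dots,n-\bar r+1\}$, are all strictly externally positive (respectively, all strictly externally negative), except for the following cases: if $\beta=\{\bar t,\dots,\bar t+\bar r-1\}$ with $\bar r=k$ and $\bar t\in\{k+1,\dots,n-k+1\}$, then (for any $r\in\{1,\dots,k\}$) non-strict external positivity (respectively, negativity) of $(\tilde A_r,\tilde b_{k,r,\beta},\tilde c_r)$ is sufficient, provided that $\tilde c_r\tilde A_r^{l-1}\tilde b_{k,r,\beta}\neq0$ for all $l\in\{1,\dots,k\}$.
   Context: Observability: for $A\in\mathbb{R}^{n\times n}$, $c\in\mathbb{R}^{1\times n}$, the observability operator $\mathcal{O}=\mathcal{O}(A,c):\mathbb{R}^n\to\mathbb{R}^{\mathbb{Z}_{\ge 0}}$ is $(\mathcal{O}x_0)(t):=cA^tx_0$, $t\ge 0$. For $t\ge1$, $\mathcal{O}^t\in\mathbb{R}^{t\times n}$ is the matrix with rows $c, cA,\dots,cA^{t-1}$ (in this order). $(A,c)$ is observable if $\mathcal{O}^n$ is invertible. Index sets and submatrices: $\mathcal{I}_{n,k}$ is the set of $k$-element subsets of $\{1,\dots,n\}$, listed increasingly. $X_{\alpha,\beta}$ is the submatrix of $X$ with rows $\alpha$ and columns $\beta$. A set $\{i,\dots,j\}$ with $i>j$ is empty. $I_j$ is the $j\times j$ identity matrix. Compound matrices: for $X\in\mathbb{R}^{p\times q}$ and $1\le r\le\min\{p,q\}$, $X_{[r]}\in\mathbb{R}^{\binom{p}{r}\times\binom{q}{r}}$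 is the $r$-th multiplicative compound matrix: its entries are the $r\times r$ minors $\det X_{I,J}$, with $I\in\mathcal{I}_{p,r}$, $J\in\mathcal{I}_{q,r}$ ordered lexicographically. External positivity: a triple $(\tilde A,\tilde b,\tilde c)$ (square matrix, column vector, row vector of compatible sizes) is externally positive (negative) if $\tilde c\tilde A^{t-1}\tilde b\ge0$ ($\le0$) for all integers $t\ge1$, and strictly externally positive (negative) if $\tilde c\tilde A^{t-1}\tilde b>0$ ($<0$) for all integers $t\ge1$. Variation: for a real vector or sequence $u\neq0$, $S^-(u)$ is the number of sign changes in $u$ after deleting all zero entries, and $S^-(0):=-1$. A linear map $u\mapsto Xu$ is $k$-variation bounding ($k\in\mathbb{Z}_{\ge0}$) if $S^-(Xu)\le k$ for all $u\ne0$ with $S^-(u)\le k$. *)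

theory Defs
  imports
    "HOL-Library.Extended_Real"
    "HOL-Library.List_Lexorder"
    "Jordan_Normal_Form.Determinant"
    "Jordan_Normal_Form.Gauss_Jordan_Elimination"
    "Jordan_Normal_Form.DL_Submatrix"
begin

section \<open>Index sets, submatrices and compound matrices\<close>

text \<open>Index sets are 1-based subsets of \<open>{1..n}\<close>, whereas matrices are 0-based. The shift is made in
  \<open>submat\<close> only.\<close>

definition index_sets :: "nat \<Rightarrow> nat \<Rightarrow> nat set set" where
  "index_sets n k = {\<alpha>. \<alpha> \<subseteq> {1..n} \<and> card \<alpha> = k}"

text \<open>The outer \<open>sorted_list_of_set\<close> is taken with respect to the lexicographic order on lists
  provided by \<open>List_Lexorder\<close>.\<close>

definition index_list :: "nat \<Rightarrow> nat \<Rightarrow> nat set list" where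
  "index_list n k = map set (sorted_list_of_set (sorted_list_of_set ` index_sets n k))"

definition submat :: "'a mat \<Rightarrow> nat set \<Rightarrow> nat set \<Rightarrow> 'a mat" where
  "submat X \<alpha> \<beta> = submatrix X (Suc -` \<alpha>) (Suc -` \<beta>)"

definition compound :: "nat \<Rightarrow> 'a :: comm_ring_1 mat \<Rightarrow> 'a mat" where
  "compound r X = mat (dim_row X choose r) (dim_col X choose r)
     (\<lambda>(i, j). det (submat X (index_list (dim_row X) r ! i) (index_list (dim_col X) r ! j)))"

lemma finite_index_sets: "finite (index_sets n k)"
  by (rule finite_subset[of _ "Pow {1..n}"]) (auto simp: index_sets_def)

lemma set_index_list: "set (index_list n k) = index_sets n k"
proof -
  have "finite \<alpha>" if "\<alpha> \<in> index_sets n k" for \<alpha>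
    using that finite_subset by (auto simp: index_sets_def)
  then show ?thesis
    by (simp add: index_list_def finite_index_sets image_image cong: image_cong_simp)
qed

lemma length_index_list: "length (index_list n k) = n choose k"
proof -
  have "inj_on sorted_list_of_set (index_sets n k)"
  proof (rule inj_onI)
    fix \<alpha> \<beta> assume "\<alpha> \<in> index_sets n k" "\<beta> \<in> index_sets n k"
      "sorted_list_of_set \<alpha> = sorted_list_of_set \<beta>"
    moreover have "finite \<alpha>" "finite \<beta>"
      using calculation finite_subset by (auto simp: index_sets_def)
    ultimately show "\<alpha> = \<beta>" by (metis set_sorted_list_of_set)
  qed
  then have "length (index_list n k) = card (index_sets n k)"
    by (simp add: index_list_def card_image)
  also have "\<dots> = n choose k"
    using n_subsets[of "{1..n}" k] by (simp add: index_sets_def)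
  finally show ?thesis .
qed

section \<open>Observability\<close>

text \<open>Throughout, \<open>A\<close> is \<open>n \<times> n\<close> and the row vector \<open>c\<close> is a \<open>1 \<times> n\<close> matrix.\<close>

definition obs_op :: "real mat \<Rightarrow> real mat \<Rightarrow> real vec \<Rightarrow> nat \<Rightarrow> real" where
  "obs_op A c x t = ((c * A ^\<^sub>m t) *\<^sub>v x) $ 0"

definition obs_mat :: "real mat \<Rightarrow> real mat \<Rightarrow> nat \<Rightarrow> real mat" where
  "obs_mat A c t = mat t (dim_col A) (\<lambda>(i, j). (c * A ^\<^sub>m i) $$ (0, j))"

definition observable :: "real mat \<Rightarrow> real mat \<Rightarrow> bool" where
  "observable A c \<longleftrightarrow> invertible_mat (obs_mat A c (dim_row A))"

section \<open>External positivity\<close>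

text \<open>Here \<open>b\<close> is a one-column matrix and \<open>c\<close> a one-row matrix.\<close>

definition impulse_response :: "real mat \<Rightarrow> real mat \<Rightarrow> real mat \<Rightarrow> nat \<Rightarrow> real" where
  "impulse_response A b c t = (c * A ^\<^sub>m (t - 1) * b) $$ (0, 0)"

definition externally_positive :: "real mat \<Rightarrow> real mat \<Rightarrow> real mat \<Rightarrow> bool" where
  "externally_positive A b c \<longleftrightarrow> (\<forall>t\<ge>1. impulse_response A b c t \<ge> 0)"

definition externally_negative :: "real mat \<Rightarrow> real mat \<Rightarrow> real mat \<Rightarrow> bool" where
  "externally_negative A b c \<longleftrightarrow> (\<forall>t\<ge>1. impulse_response A b c t \<le> 0)"

definition strictly_externally_positive :: "real mat \<Rightarrow> real mat \<Rightarrow> real mat \<Rightarrow> bool" where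
  "strictly_externally_positive A b c \<longleftrightarrow> (\<forall>t\<ge>1. impulse_response A b c t > 0)"

definition strictly_externally_negative :: "real mat \<Rightarrow> real mat \<Rightarrow> real mat \<Rightarrow> bool" where
  "strictly_externally_negative A b c \<longleftrightarrow> (\<forall>t\<ge>1. impulse_response A b c t < 0)"

section \<open>Variation\<close>

text \<open>A vector or sequence is a function \<open>u\<close> on an index set \<open>J\<close>. After the zero entries are deleted,
  \<open>u i\<close> and \<open>u j\<close> are neighbours iff both are nonzero and every entry strictly between them is zero.
  A sequence may change sign infinitely often.\<close>

definition sign_changes :: "nat set \<Rightarrow> (nat \<Rightarrow> real) \<Rightarrow> (nat \<times> nat) set" where
  "sign_changes J u = {(i, j). i \<in> J \<and> j \<in> J \<and> i < j \<and> u i * u j < 0 \<and>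
     (\<forall>l\<in>J. i < l \<and> l < j \<longrightarrow> u l = 0)}"

definition variation :: "nat set \<Rightarrow> (nat \<Rightarrow> real) \<Rightarrow> ereal" where
  "variation J u =
     (if \<forall>i\<in>J. u i = 0 then - 1
      else if finite (sign_changes J u) then ereal (real (card (sign_changes J u)))
      else \<infinity>)"

text \<open>\<open>F\<close> maps vectors of dimension \<open>n\<close> to real sequences.\<close>

definition variation_bounding :: "nat \<Rightarrow> nat \<Rightarrow> (real vec \<Rightarrow> nat \<Rightarrow> real) \<Rightarrow> bool" where
  "variation_bounding n k F \<longleftrightarrow>
     (\<forall>u \<in> carrier_vec n. u \<noteq> 0\<^sub>v n \<longrightarrow> variation {..<n} (($) u) \<le> ereal (real k) \<longrightarrow>
        variation UNIV (F u) \<le> ereal (real k))"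

section \<open>The compound systems\<close>

definition append_cols :: "'a :: zero mat \<Rightarrow> 'a mat \<Rightarrow> 'a mat" where
  "append_cols X Y = four_block_mat X Y (0\<^sub>m 0 (dim_col X)) (0\<^sub>m 0 (dim_col Y))"

definition P_mat :: "nat \<Rightarrow> nat set \<Rightarrow> real mat" where
  "P_mat n \<beta> = submat (1\<^sub>m n) {1..n} \<beta>"

definition sys_A :: "real mat \<Rightarrow> nat \<Rightarrow> real mat" where
  "sys_A A r = compound r A"

definition sys_c :: "real mat \<Rightarrow> real mat \<Rightarrow> nat \<Rightarrow> real mat" where
  "sys_c A c r = compound r (obs_mat A c r)"

text \<open>\<open>the (mat_inverse M)\<close> is the inverse of \<open>M\<close> whenever \<open>M\<close> is invertible.\<close>

definition sys_b :: "real mat \<Rightarrow> real mat \<Rightarrow> nat \<Rightarrow> nat \<Rightarrow> nat set \<Rightarrow> real mat" where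
  "sys_b A c k r \<beta> =
     (let n = dim_row A;
          O\<^sub>n = obs_mat A c n;
          E = 0\<^sub>m (k - r) (n - k + r) @\<^sub>r 1\<^sub>m (n - k + r)
      in append_cols
           (compound r (A ^\<^sub>m (k - r) * the (mat_inverse O\<^sub>n) * E))
           (0\<^sub>m (n choose r) ((n choose k) - ((n - k + r) choose r)))
         * compound k (O\<^sub>n * P_mat n \<beta>))"

end

theory Submission
  imports Defs
begin

text \<open>Write \<open>O\<close> for the infinite observability matrix, with rows \<open>c A^i\<close>.

Part (a) is two applications of the Cauchy--Binet formula. Since \<open>O\<^sup>n\<close> is invertible, \<open>O\<close> factors as
\<open>Z O\<^sup>n\<close> with \<open>Z = O (O\<^sup>n)^-1\<close>, and a minor of \<open>O\<close> with rows \<open>\<alpha>\<close> and columns \<open>\<beta>\<close> is the sum over \<open>k\<close>-sets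
\<open>J\<close> of \<open>det Z(\<alpha>, J) det O\<^sup>n(J, \<beta>)\<close>. The first \<open>n\<close> rows of \<open>Z\<close> are unit vectors. As \<open>\<alpha>\<close> contains
\<open>{1..k - r}\<close>, only the sets \<open>J\<close> containing \<open>{1..k - r}\<close> contribute, and for them the factor
\<open>det Z(\<alpha>, J)\<close> reduces to an \<open>r\<close>-minor of \<open>O\<^sup>r A^(t - 1) A^(k - r) (O\<^sup>n)^-1\<close> in the remaining columns.
These \<open>J\<close> are exactly the lexicographically first ones (\<open>index_list_split\<close>), which explains the
block of zeros in the input vector; multiplicativity of compound matrices (\<open>compound_mult\<close>)
separates the powers of \<open>A\<close> (\<open>impulse_response_eq_minor\<close>).

By (a), the hypotheses of (b) prescribe the signs of the \<open>k\<close>-minors of \<open>O\<close> for which both the row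
set and the column set have the form \<open>{1..k - r} \<union> {i..i + r - 1}\<close>; call such sets initial. Two
steps lead to the variation bound.

The first step shows that all \<open>k\<close>-minors have the same weak sign, and that those whose column set
contains the first index do not vanish. The maximal minors of a matrix with \<open>k\<close>
columns satisfy the three-term Pluecker relations, in which products of minors are related without
subtraction. They make it possible to close gaps in an index set: if the minors on sets containing
the first index are positive, then positivity on intervals spreads to all sets
(\<open>positivity_from_intervals\<close>). Sets containing the first index are treated by induction on \<open>k\<close>, after
that index is removed from all sets (\<open>positivity_from_initial_sets\<close>). This is applied first to
the columns, for an initial row set, and then to the rows, for an arbitrary column set. Where the
hypotheses are not strict, a multiple \<open>\<epsilon>\<close> of the first column is added to one column: this makes
the minors strictly positive, and \<open>\<epsilon>\<close> tends to \<open>0\<close> (\<open>minors_nonneg_from_initial_minors\<close>).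

The second step is Schoenberg's argument. Let \<open>u\<close> have at most \<open>k - 1\<close> sign changes. A small
perturbation leaves no zero entries in \<open>u\<close>, so its index range splits into \<open>k\<close> blocks of constant
sign. The columns of \<open>O\<close>, weighted by the entries of \<open>u\<close> up to sign and summed over each block, form
a matrix \<open>V\<close> with \<open>k\<close> columns, and \<open>O u\<close> is a combination of the columns of \<open>V\<close>. All \<open>k\<close>-minors of \<open>V\<close>
have the same strict sign, because each is a positive combination of \<open>k\<close>-minors of \<open>O\<close>, some of whose
column sets contain the first index. If \<open>O u\<close> had \<open>k\<close> sign changes, then in the expansion of the
vanishing determinant of \<open>k + 1\<close> rows of \<open>V\<close> extended by \<open>O u\<close> all terms would have the same sign
(\<open>variation_bounding_from_minors\<close>).\<close>

section \<open>Minors indexed by lists of rows and columns\<close>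

text \<open>Rows and columns are given as lists rather than as sets: lists may be unsorted or repeat an entry, as
is needed to expand determinants and to keep track of signs. Minors in the usual sense arise from sorted
lists.\<close>

definition minor :: "(nat \<Rightarrow> nat \<Rightarrow> 'a :: comm_ring_1) \<Rightarrow> nat list \<Rightarrow> nat list \<Rightarrow> 'a" where
  "minor X rs cs = det (mat (length rs) (length cs) (\<lambda>(i, j). X (rs ! i) (cs ! j)))"

lemma minor_transpose:
  assumes "length rs = length cs"
  shows "minor (\<lambda>i j. X j i) cs rs = minor X rs cs"
proof -
  let ?M = "mat (length rs) (length cs) (\<lambda>(i, j). X (rs ! i) (cs ! j))"
  have "mat (length cs) (length rs) (\<lambda>(i, j). X (rs ! j) (cs ! i)) = transpose_mat ?M"
    by (rule eq_matI) auto
  then show ?thesis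
    using det_transpose[of ?M "length cs"] assms by (simp add: minor_def)
qed

lemma minor_swap_adjacent:
  assumes "length xs + length ys + 2 = length cs"
  shows "minor X (xs @ a # b # ys) cs = - minor X (xs @ b # a # ys) cs"
proof -
  let ?n = "length cs" and ?k = "length xs"
  let ?M = "\<lambda>rs. mat ?n ?n (\<lambda>(i, j). X (rs ! i) (cs ! j))"
  have "?M (xs @ a # b # ys) = swaprows ?k (Suc ?k) (?M (xs @ b # a # ys))"
  proof (rule eq_matI)
    fix i j assume "i < dim_row (swaprows ?k (Suc ?k) (?M (xs @ b # a # ys)))"
      "j < dim_col (swaprows ?k (Suc ?k) (?M (xs @ b # a # ys)))"
    then have ij: "i < ?n" "j < ?n" by auto
    have "(xs @ a # b # ys) ! i = (xs @ b # a # ys) !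
      (if i = ?k then Suc ?k else if i = Suc ?k then ?k else i)"
      by (auto simp: nth_append nth_Cons split: nat.splits)
    then show "?M (xs @ a # b # ys) $$ (i, j) = swaprows ?k (Suc ?k) (?M (xs @ b # a # ys)) $$ (i, j)"
      using ij assms by auto
  qed auto
  moreover have "length (xs @ a # b # ys) = ?n" "length (xs @ b # a # ys) = ?n" using assms by auto
  ultimately show ?thesis
    using det_swaprows[of ?k ?n "Suc ?k" "?M (xs @ b # a # ys)"] assms
    unfolding minor_def by simp
qed

lemma minor_move_row:
  assumes "length ps + length xs + length ys + 1 = length cs"
  shows "minor X (ps @ x # xs @ ys) cs = (- 1) ^ length xs * minor X (ps @ xs @ x # ys) cs"
  using assms
proof (induction xs arbitrary: ps)
  case (Cons y xs)
  have "minor X (ps @ x # (y # xs) @ ys) cs = - minor X ((ps @ [y]) @ x # xs @ ys) cs"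
    using minor_swap_adjacent[of ps "xs @ ys" cs X x y] Cons.prems by simp
  also have "\<dots> = (- 1) ^ length (y # xs) * minor X (ps @ (y # xs) @ x # ys) cs"
    using Cons.IH[of "ps @ [y]"] Cons.prems by simp
  finally show ?case .
qed simp

lemma minor_repeated_row:
  assumes "length rs = length cs" "\<not> distinct rs"
  shows "minor X rs cs = 0"
proof -
  obtain i j where ij: "i < length rs" "j < length rs" "i \<noteq> j" "rs ! i = rs ! j"
    using assms(2) by (auto simp: distinct_conv_nth)
  show ?thesis unfolding minor_def
    by (rule det_identical_rows[of _ "length cs" i j]) (use ij assms in auto)
qed

text \<open>The cofactors do not depend on the first row. The matrix \<open>Y\<close> may therefore differ from \<open>X\<close> in that
row, which gives linearity in it.\<close>

lemma minor_expand_row: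
  assumes "length cs = Suc (length rs)"
  obtains C where "\<And>Y a. (\<And>r c. r \<in> set rs \<Longrightarrow> Y r c = X r c) \<Longrightarrow>
    minor Y (a # rs) cs = (\<Sum>j<length cs. Y a (cs ! j) * C j)"
proof
  let ?n = "length cs"
  let ?C = "\<lambda>j. (- 1) ^ j * det (mat (length rs) (length rs)
      (\<lambda>(i', j'). X (rs ! i') (cs ! (if j' < j then j' else Suc j'))))"
  fix Y a assume eq: "\<And>r c. r \<in> set rs \<Longrightarrow> Y r c = X r c"
  let ?M = "mat ?n ?n (\<lambda>(i, j). Y ((a # rs) ! i) (cs ! j))"
  have "det ?M = (\<Sum>j<?n. ?M $$ (0, j) * cofactor ?M 0 j)"
    by (rule laplace_expansion_row) (use assms in auto)
  also have "\<dots> = (\<Sum>j<?n. Y a (cs ! j) * ?C j)"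
  proof (rule sum.cong[OF refl])
    fix j assume j: "j \<in> {..<?n}"
    have "mat_delete ?M 0 j = mat (length rs) (length rs)
      (\<lambda>(i', j'). X (rs ! i') (cs ! (if j' < j then j' else Suc j')))"
      by (rule eq_matI) (use assms eq in \<open>auto simp: mat_delete_def\<close>)
    then show "?M $$ (0, j) * cofactor ?M 0 j = Y a (cs ! j) * ?C j"
      using j assms by (simp add: cofactor_def)
  qed
  finally show "minor Y (a # rs) cs = (\<Sum>j<?n. Y a (cs ! j) * ?C j)"
    using assms unfolding minor_def by simp
qed

text \<open>A matrix with one more row than columns becomes square and singular when one of its columns is
duplicated; this is the expansion of its determinant along the duplicate.\<close>

lemma minor_laplace_relation:
  assumes "length rs = Suc (length cs)" "j < length cs"
  shows "(\<Sum>i<length rs. (- 1) ^ i * X (rs ! i) (cs ! j) *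
           minor X (take i rs @ drop (Suc i) rs) cs) = 0"
proof -
  let ?n = "length rs"
  let ?M = "mat ?n ?n (\<lambda>(i, j'). X (rs ! i) ((cs ! j # cs) ! j'))"
  have "0 = det ?M"
  proof (rule det_identical_columns[symmetric, of _ ?n 0 "Suc j"])
    show "col ?M 0 = col ?M (Suc j)" by (rule eq_vecI) (use assms in auto)
  qed (use assms in auto)
  also have "\<dots> = (\<Sum>i<?n. ?M $$ (i, 0) * cofactor ?M i 0)"
    by (rule laplace_expansion_column) (use assms in auto)
  also have "\<dots> = (\<Sum>i<?n. (- 1) ^ i * X (rs ! i) (cs ! j) *
           minor X (take i rs @ drop (Suc i) rs) cs)"
  proof (rule sum.cong[OF refl])
    fix i assume i: "i \<in> {..<?n}"
    have "mat_delete ?M i 0 = mat (length cs) (length cs)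
      (\<lambda>(i', j'). X ((take i rs @ drop (Suc i) rs) ! i') (cs ! j'))"
      by (rule eq_matI) (use assms i in \<open>auto simp: mat_delete_def nth_append\<close>)
    moreover have "length (take i rs @ drop (Suc i) rs) = length cs" using assms i by auto
    ultimately show "?M $$ (i, 0) * cofactor ?M i 0 = (- 1) ^ i * X (rs ! i) (cs ! j) *
           minor X (take i rs @ drop (Suc i) rs) cs"
      using i assms(1) unfolding minor_def cofactor_def by simp
  qed
  finally show ?thesis by simp
qed

text \<open>Apply the linear form \<open>x \<mapsto> minor X (x # ts) cs\<close> to the linear dependence between the rows \<open>rs\<close>
from \<open>minor_laplace_relation\<close>.\<close>

lemma minor_grassmann_pluecker:
  assumes "length rs = Suc (length cs)" "Suc (length ts) = length cs"
  shows "(\<Sum>i<length rs. (- 1) ^ i * minor X (rs ! i # ts) cs *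
           minor X (take i rs @ drop (Suc i) rs) cs) = 0"
proof -
  let ?P = "\<lambda>i. minor X (take i rs @ drop (Suc i) rs) cs"
  obtain C where C: "\<And>a. minor X (a # ts) cs = (\<Sum>j<length cs. X a (cs ! j) * C j)"
    using minor_expand_row[of cs ts X] assms(2) by metis
  have "(\<Sum>i<length rs. (- 1) ^ i * minor X (rs ! i # ts) cs * ?P i) =
    (\<Sum>i<length rs. \<Sum>j<length cs. C j * ((- 1) ^ i * X (rs ! i) (cs ! j) * ?P i))"
    unfolding C sum_distrib_left sum_distrib_right by (intro sum.cong refl) (simp add: ac_simps)
  also have "\<dots> = (\<Sum>j<length cs. C j * (\<Sum>i<length rs. (- 1) ^ i * X (rs ! i) (cs ! j) * ?P i))"
    unfolding sum_distrib_left by (rule sum.swap)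
  also have "\<dots> = 0"
  proof (intro sum.neutral ballI)
    fix j assume "j \<in> {..<length cs}"
    then have "(\<Sum>i<length rs. (- 1) ^ i * X (rs ! i) (cs ! j) * ?P i) = 0"
      by (intro minor_laplace_relation assms(1)) simp
    then show "C j * (\<Sum>i<length rs. (- 1) ^ i * X (rs ! i) (cs ! j) * ?P i) = 0"
      by (simp only: mult_zero_right)
  qed
  finally show ?thesis .
qed

section \<open>Pluecker relations\<close>

text \<open>In the Grassmann--Pluecker relation for the row lists \<open>b # c # d # S\<close> and \<open>a # S\<close> all terms but three have
a repeated row.\<close>

lemma minor_three_term:
  assumes "length S + 2 = length cs"
  shows "minor X (a # c # S) cs * minor X (b # d # S) cs =
    minor X (a # b # S) cs * minor X (c # d # S) cs + minor X (a # d # S) cs * minor X (b # c # S) cs"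
proof -
  let ?rs = "b # c # d # S"
  let ?t = "\<lambda>i. (- 1) ^ i * minor X (?rs ! i # a # S) cs * minor X (take i ?rs @ drop (Suc i) ?rs) cs"
  have "(\<Sum>i<length ?rs. ?t i) = 0"
    by (rule minor_grassmann_pluecker) (use assms in auto)
  moreover have "(\<Sum>i<length ?rs. ?t i) = ?t 0 + (?t 1 + (?t 2 + (\<Sum>i<length S. ?t (3 + i))))"
    by (simp add: sum.lessThan_Suc_shift numeral_2_eq_2 numeral_3_eq_3 del: sum.lessThan_Suc)
  moreover have "(\<Sum>i<length S. ?t (3 + i)) = 0"
    by (rule sum.neutral) (use assms in \<open>auto simp: minor_repeated_row numeral_3_eq_3\<close>)
  moreover have "minor X (y # a # S) cs = - minor X (a # y # S) cs" for y
    using minor_swap_adjacent[of "[]" S cs X y a] assms by simp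
  ultimately have "- (minor X (a # b # S) cs * minor X (c # d # S) cs)
     + (minor X (a # c # S) cs * minor X (b # d # S) cs
     + - (minor X (a # d # S) cs * minor X (b # c # S) cs)) = 0"
    by (simp add: numeral_2_eq_2)
  then show ?thesis by (simp add: algebra_simps)
qed

abbreviation sorted_elems :: "nat set \<Rightarrow> nat list" where
  "sorted_elems \<equiv> sorted_list_of_set"

lemma sorted_elems_insert:
  assumes "finite S" "x \<notin> S"
  shows "sorted_elems (insert x S) = sorted_elems {s \<in> S. s < x} @ x # sorted_elems {s \<in> S. x < s}"
proof (rule sorted_distinct_set_unique)
  have "set (sorted_elems (insert x S)) = insert x S"
    using assms(1) by (intro set_sorted_list_of_set) simp
  then show "set (sorted_elems (insert x S)) =
      set (sorted_elems {s \<in> S. s < x} @ x # sorted_elems {s \<in> S. x < s})"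
    using assms by auto
  show "sorted (sorted_elems (insert x S))" "distinct (sorted_elems (insert x S))"
    by (simp_all del: sorted_list_of_set_insert_remove sorted_list_of_set.sorted_key_list_of_set_insert)
qed (use assms in \<open>auto simp: sorted_append less_imp_le\<close>)

lemma sorted_elems_split:
  assumes "finite S" "x \<notin> S"
  shows "sorted_elems S = sorted_elems {s \<in> S. s < x} @ sorted_elems {s \<in> S. x < s}"
proof (rule sorted_distinct_set_unique)
  show "set (sorted_elems S) = set (sorted_elems {s \<in> S. s < x} @ sorted_elems {s \<in> S. x < s})"
    using assms by (auto simp: neq_iff) (metis neq_iff)
  show "sorted (sorted_elems {s \<in> S. s < x} @ sorted_elems {s \<in> S. x < s})"
    using assms by (auto simp: sorted_append)
qed (use assms in auto)

text \<open>Moving a row to its place in the sorted list costs one sign for each smaller row.\<close>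

lemma minor_insert_row:
  assumes "finite S" "x \<notin> S" "length ps + card S + 1 = length cs"
  shows "minor X (ps @ x # sorted_elems S) cs =
    (- 1) ^ card {s \<in> S. s < x} * minor X (ps @ sorted_elems (insert x S)) cs"
proof -
  have "card S = length (sorted_elems {s \<in> S. s < x} @ sorted_elems {s \<in> S. x < s})"
    using sorted_elems_split[OF assms(1,2)] by (metis length_sorted_list_of_set)
  then have "length ps + length (sorted_elems {s \<in> S. s < x}) +
      length (sorted_elems {s \<in> S. x < s}) + 1 = length cs"
    using assms(3) by simp
  from minor_move_row[OF this, of X x] show ?thesis
    unfolding sorted_elems_insert[OF assms(1,2)] sorted_elems_split[OF assms(1,2)]
      length_sorted_list_of_set .
qed

lemma minor_insert_two_rows:
  assumes "finite S" "x \<notin> S" "y \<notin> S" "x < y" "card S + 2 = length cs"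
  shows "minor X (x # y # sorted_elems S) cs = (- 1) ^ (card {s \<in> S. s < x} + card {s \<in> S. s < y}) *
    minor X (sorted_elems (insert x (insert y S))) cs"
proof -
  have "{s \<in> insert y S. s < x} = {s \<in> S. s < x}" using assms by auto
  then show ?thesis
    using minor_insert_row[of S y "[x]" cs X] minor_insert_row[of "insert y S" x "[]" cs X] assms
    by (simp add: power_add ac_simps)
qed

text \<open>The relations are isolated as a property of a set function \<open>p\<close> on the \<open>k\<close>-subsets of \<open>U\<close>, because the
positivity arguments below use nothing else about minors and, unlike a matrix, \<open>p\<close> passes directly
to the sets that contain a fixed index.\<close>

definition pluecker_relations :: "nat set \<Rightarrow> nat \<Rightarrow> (nat set \<Rightarrow> real) \<Rightarrow> bool" where
  "pluecker_relations U k p \<longleftrightarrow> (\<forall>S a b c d. finite S \<longrightarrow> S \<subseteq> U \<longrightarrow> {a, b, c, d} \<subseteq> U - S \<longrightarrow>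
     card S + 2 = k \<longrightarrow> a < b \<longrightarrow> b < c \<longrightarrow> c < d \<longrightarrow>
     p (insert a (insert c S)) * p (insert b (insert d S)) =
     p (insert a (insert b S)) * p (insert c (insert d S)) +
     p (insert a (insert d S)) * p (insert b (insert c S)))"

text \<open>Sorting the two rows \<open>x < y\<close> into \<open>S\<close> gives a sign that is a product of a sign for \<open>x\<close> and a sign for \<open>y\<close>.
Each of the three products involves every one of \<open>a\<close>, \<open>b\<close>, \<open>c\<close>, \<open>d\<close> once, so all signs cancel. The factor
\<open>\<sigma>\<close> allows for minors that are all negative; it enters every product quadratically.\<close>

lemma pluecker_relations_minor:
  "pluecker_relations U (length cs) (\<lambda>\<alpha>. \<sigma> * minor X (sorted_elems \<alpha>) cs)"
  unfolding pluecker_relations_def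
proof (intro allI impI)
  fix S a b c d
  assume S: "finite S" "{a, b, c, d} \<subseteq> U - S" "card S + 2 = length cs" "a < b" "b < c" "c < d"
  let ?n = "\<lambda>x. card {s \<in> S. s < x}"
  let ?p = "\<lambda>x y. minor X (sorted_elems (insert x (insert y S))) cs"
  have q: "minor X (x # y # sorted_elems S) cs = (- 1) ^ (?n x + ?n y) * ?p x y"
    if "x \<in> {a, b, c, d}" "y \<in> {a, b, c, d}" "x < y" for x y
    using minor_insert_two_rows[of S x y cs X] that S by auto
  let ?e = "(- 1 :: real) ^ (?n a + ?n b + ?n c + ?n d)"
  have "?e * (?p a c * ?p b d) = ?e * (?p a b * ?p c d + ?p a d * ?p b c)"
    using minor_three_term[of "sorted_elems S" cs X a c b d] S
    by (simp add: q power_add algebra_simps)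
  then have "?p a c * ?p b d = ?p a b * ?p c d + ?p a d * ?p b c"
    by simp
  from arg_cong[OF this, of "\<lambda>z. \<sigma> * \<sigma> * z"]
  show "\<sigma> * ?p a c * (\<sigma> * ?p b d) = \<sigma> * ?p a b * (\<sigma> * ?p c d) + \<sigma> * ?p a d * (\<sigma> * ?p b c)"
    by (simp add: algebra_simps)
qed

section \<open>Positivity of all maximal minors from the initial ones\<close>

lemma pluecker_relations_contract:
  assumes "pluecker_relations U (Suc k) p" "e \<in> U"
  shows "pluecker_relations (U - {e}) k (\<lambda>\<alpha>. p (insert e \<alpha>))"
  unfolding pluecker_relations_def
proof (intro allI impI)
  fix S a b c d
  assume S: "finite S" "S \<subseteq> U - {e}" "{a, b, c, d} \<subseteq> U - {e} - S" "card S + 2 = k"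
    "a < b" "b < c" "c < d"
  then have "e \<notin> S" "S \<subseteq> U" by auto
  then have "card (insert e S) + 2 = Suc k" using S by simp
  then show "p (insert e (insert a (insert c S))) * p (insert e (insert b (insert d S))) =
     p (insert e (insert a (insert b S))) * p (insert e (insert c (insert d S))) +
     p (insert e (insert a (insert d S))) * p (insert e (insert b (insert c S)))"
    using assms(1)[unfolded pluecker_relations_def, rule_format, of "insert e S" a b c d] S assms(2)
      \<open>S \<subseteq> U\<close>
    by (simp add: insert_commute)
qed

lemma finite_set_eq_interval_or_gap:
  fixes \<alpha> :: "nat set"
  assumes "finite \<alpha>" "\<alpha> \<noteq> {}"
  shows "\<alpha> = {Min \<alpha>..<Min \<alpha> + card \<alpha>} \<or> (\<exists>g. g \<notin> \<alpha> \<and> Min \<alpha> < g \<and> g < Max \<alpha>)"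
proof (rule disjCI)
  assume no_gap: "\<not> (\<exists>g. g \<notin> \<alpha> \<and> Min \<alpha> < g \<and> g < Max \<alpha>)"
  have "\<alpha> = {Min \<alpha>..Max \<alpha>}"
  proof
    show "\<alpha> \<subseteq> {Min \<alpha>..Max \<alpha>}" using assms by auto
    show "{Min \<alpha>..Max \<alpha>} \<subseteq> \<alpha>"
    proof
      fix x assume x: "x \<in> {Min \<alpha>..Max \<alpha>}"
      show "x \<in> \<alpha>"
      proof (cases "x = Min \<alpha> \<or> x = Max \<alpha>")
        case True
        then show ?thesis using Min_in[OF assms] Max_in[OF assms] by auto
      next
        case False
        then have "Min \<alpha> < x" "x < Max \<alpha>" using x by (auto simp: order.strict_iff_order)
        then show ?thesis using no_gap by blast
      qed
    qed
  qed
  moreover have "Min \<alpha> \<le> Max \<alpha>" using assms by simp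
  ultimately show "\<alpha> = {Min \<alpha>..<Min \<alpha> + card \<alpha>}"
    by (metis Suc_diff_le atLeastLessThanSuc_atLeastAtMost card_atLeastAtMost le_SucI
        ordered_cancel_comm_monoid_diff_class.add_diff_inverse)
qed

text \<open>Induction on the width \<open>Max \<alpha> - Min \<alpha>\<close>. If \<open>\<alpha>\<close> is not an interval and misses \<open>a\<close>, let \<open>g\<close> be a gap of \<open>\<alpha>\<close>.
The three-term relation for \<open>a < Min \<alpha> < g < Max \<alpha>\<close> expresses \<open>p \<alpha>\<close>, up to a positive factor, as a
positive combination of the values at two sets in which \<open>g\<close> replaces one end of \<open>\<alpha>\<close>, and which are
therefore narrower. The predicate \<open>Q\<close> lets the strict and the weak version share this proof.\<close>

lemma positivity_from_intervals:
  fixes p :: "nat set \<Rightarrow> real"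
  assumes pl: "pluecker_relations {a..<L} k p"
    and Q: "Q = (\<lambda>x. 0 < x) \<or> Q = (\<lambda>x. 0 \<le> x)"
    and first: "\<And>\<alpha>. \<alpha> \<subseteq> {a..<L} \<Longrightarrow> card \<alpha> = k \<Longrightarrow> a \<in> \<alpha> \<Longrightarrow> 0 < p \<alpha>"
    and intervals: "\<And>s. a \<le> s \<Longrightarrow> s + k \<le> L \<Longrightarrow> Q (p {s..<s + k})"
    and "0 < k" "\<alpha> \<subseteq> {a..<L}" "card \<alpha> = k"
  shows "Q (p \<alpha>)"
  using assms(6,7)
proof (induction "Max \<alpha> - Min \<alpha>" arbitrary: \<alpha> rule: less_induct)
  case (less \<alpha>)
  have fin: "finite \<alpha>" using less.prems(1) finite_subset by blast
  have ne: "\<alpha> \<noteq> {}" using less.prems(2) \<open>0 < k\<close> by auto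
  define m M where "m = Min \<alpha>" and "M = Max \<alpha>"
  have mM: "m \<in> \<alpha>" "M \<in> \<alpha>" "\<And>x. x \<in> \<alpha> \<Longrightarrow> m \<le> x \<and> x \<le> M"
    using fin ne by (auto simp: m_def M_def)
  then have bounds: "a \<le> m" "M < L" using less.prems(1) by auto
  consider "a \<in> \<alpha>" | "\<alpha> = {m..<m + k}" | g where "a \<notin> \<alpha>" "g \<notin> \<alpha>" "m < g" "g < M"
    using finite_set_eq_interval_or_gap[OF fin ne] less.prems(2) unfolding m_def M_def by auto
  then show ?case
  proof cases
    case 1
    then show ?thesis using first[OF less.prems] Q by auto
  next
    case 2
    then have "m + k \<le> L"
      using less.prems(1) \<open>0 < k\<close> by (auto simp: subset_eq dest!: bspec[of _ _ "m + k - 1"])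
    then show ?thesis using intervals[OF bounds(1)] 2 by simp
  next
    case 3
    define S where "S = \<alpha> - {m, M}"
    have S: "finite S" "\<alpha> = insert m (insert M S)" "m \<notin> S" "M \<notin> S" "g \<notin> S" "a \<notin> S" "S \<subseteq> {a..<L}"
      "\<And>x. x \<in> S \<Longrightarrow> m < x \<and> x < M"
      using fin mM 3 less.prems(1) by (auto simp: S_def order.strict_iff_order)
    have "m < M" using 3 by simp
    then have card_S: "card S + 2 = k" using S less.prems(2) by auto
    have "a < m" using 3 mM(1) bounds(1) by (auto simp: order.strict_iff_order)
    have rel: "p (insert a (insert g S)) * p \<alpha> =
       p (insert a (insert m S)) * p (insert g (insert M S)) +
       p (insert a (insert M S)) * p (insert m (insert g S))"
      using pl[unfolded pluecker_relations_def, rule_format, of S a m g M] S card_S 3 \<open>a < m\<close> bounds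
      by simp
    have pos: "0 < p (insert a (insert g S))" "0 < p (insert a (insert m S))"
      "0 < p (insert a (insert M S))"
      using S card_S 3 \<open>a < m\<close> bounds by (auto intro!: first)
    have "Q (p (insert g (insert M S)))"
    proof (rule less.hyps)
      have *: "finite (insert g (insert M S))" "insert g (insert M S) \<noteq> {}" using S by auto
      have "m < Min (insert g (insert M S))" using S 3 by (subst Min_gr_iff[OF *]) auto
      moreover have "Max (insert g (insert M S)) \<le> M" using S 3 by (subst Max_le_iff[OF *]) (auto intro: less_imp_le)
      ultimately show "Max (insert g (insert M S)) - Min (insert g (insert M S)) < Max \<alpha> - Min \<alpha>"
        using \<open>m < M\<close> unfolding m_def[symmetric] M_def[symmetric] by linarith
      show "insert g (insert M S) \<subseteq> {a..<L}" "card (insert g (insert M S)) = k"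
        using S card_S 3 \<open>a < m\<close> bounds by auto
    qed
    moreover have "Q (p (insert m (insert g S)))"
    proof (rule less.hyps)
      have *: "finite (insert m (insert g S))" "insert m (insert g S) \<noteq> {}" using S by auto
      have "m \<le> Min (insert m (insert g S))" using S 3 by (subst Min_ge_iff[OF *]) (auto intro: less_imp_le)
      moreover have "Max (insert m (insert g S)) < M" using S 3 by (subst Max_less_iff[OF *]) auto
      ultimately show "Max (insert m (insert g S)) - Min (insert m (insert g S)) < Max \<alpha> - Min \<alpha>"
        using \<open>m < M\<close> unfolding m_def[symmetric] M_def[symmetric] by linarith
      show "insert m (insert g S) \<subseteq> {a..<L}" "card (insert m (insert g S)) = k"
        using S card_S 3 \<open>a < m\<close> bounds by auto
    qed
    ultimately have "Q (p (insert a (insert g S)) * p \<alpha>)"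
      using Q pos unfolding rel by (auto intro: add_pos_pos)
    then show ?thesis
      using Q pos(1) by (auto simp: zero_less_mult_iff zero_le_mult_iff)
  qed
qed

text \<open>The values at sets containing \<open>a\<close> form, after removal of \<open>a\<close>, a function of the same kind for \<open>k - 1\<close>, whose
initial sets are again initial sets of \<open>p\<close> of length \<open>r < k\<close>. The remaining case \<open>r = k\<close> supplies
the intervals, and \<open>r = 0\<close> starts the induction, where the empty set is the only index set.\<close>

lemma positivity_from_initial_sets:
  fixes p :: "nat set \<Rightarrow> real"
  assumes "pluecker_relations {a..<L} k p"
    and "\<And>r s. r \<le> k \<Longrightarrow> a + (k - r) \<le> s \<Longrightarrow> s + r \<le> L \<Longrightarrow>
      0 < p ({a..<a + (k - r)} \<union> {s..<s + r})"
    and "a \<le> L" "\<alpha> \<subseteq> {a..<L}" "card \<alpha> = k"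
  shows "0 < p \<alpha>"
  using assms
proof (induction k arbitrary: a p \<alpha>)
  case 0
  then have "\<alpha> = {}" using finite_subset by fastforce
  then show ?case using "0.prems"(2)[of 0 a] "0.prems"(3) by simp
next
  case (Suc k)
  have "\<alpha> \<noteq> {}" using Suc.prems(5) by auto
  then have "a < L" using Suc.prems(4) by auto
  have contract: "0 < p (insert a \<gamma>)" if "\<gamma> \<subseteq> {Suc a..<L}" "card \<gamma> = k" for \<gamma>
  proof (rule Suc.IH[where p = "\<lambda>\<gamma>. p (insert a \<gamma>)"])
    have "{a..<L} - {a} = {Suc a..<L}" by auto
    then show "pluecker_relations {Suc a..<L} k (\<lambda>\<gamma>. p (insert a \<gamma>))"
      using pluecker_relations_contract[OF Suc.prems(1), of a] \<open>a < L\<close> by simp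
    fix r s assume rs: "r \<le> k" "Suc a + (k - r) \<le> s" "s + r \<le> L"
    then have "0 < p ({a..<a + (Suc k - r)} \<union> {s..<s + r})"
      by (intro Suc.prems(2)) auto
    moreover have "{a..<a + (Suc k - r)} = insert a {Suc a..<Suc a + (k - r)}" using rs by auto
    ultimately show "0 < p (insert a ({Suc a..<Suc a + (k - r)} \<union> {s..<s + r}))" by simp
  qed (use \<open>a < L\<close> that in auto)
  show ?case
  proof (rule positivity_from_intervals[where Q = "\<lambda>x. 0 < x", OF Suc.prems(1)])
    fix \<gamma> assume \<gamma>: "\<gamma> \<subseteq> {a..<L}" "card \<gamma> = Suc k" "a \<in> \<gamma>"
    have "\<gamma> - {a} \<subseteq> {Suc a..<L}" "card (\<gamma> - {a}) = k" using \<gamma> by auto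
    with contract[of "\<gamma> - {a}"] show "0 < p \<gamma>" using \<gamma>(3) by (simp add: insert_absorb)
  next
    fix s assume "a \<le> s" "s + Suc k \<le> L"
    then show "0 < p {s..<s + Suc k}" using Suc.prems(2)[of "Suc k" s] by simp
  qed (use Suc.prems in auto)
qed

text \<open>The strict hypothesis covers exactly the initial column sets that contain \<open>0\<close>. Hence for initial row sets
the minors with column sets containing \<open>0\<close> are positive, and by the weak hypothesis on intervals all
other ones are nonnegative. Extending this from initial to arbitrary row sets requires strict
signs on the initial row sets. For a column set \<open>\<beta>\<close> without \<open>0\<close> these are obtained by adding \<open>\<epsilon>\<close> times
column \<open>0\<close> to the first column in \<open>\<beta>\<close>: column \<open>0\<close> precedes all others, so the minor changes by \<open>\<epsilon>\<close> times
a positive minor.\<close>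

theorem minors_nonneg_from_initial_minors:
  fixes h :: "nat \<Rightarrow> nat \<Rightarrow> real" and \<sigma> :: real
  defines "m \<equiv> \<lambda>\<alpha> \<beta>. \<sigma> * minor h (sorted_elems \<alpha>) (sorted_elems \<beta>)"
  assumes k: "1 \<le> k" "k \<le> n"
    and weak: "\<And>r i r' j. \<lbrakk>r \<in> {1..k}; k - r \<le> i; r' \<in> {1..k}; k - r' \<le> j; j + r' \<le> n\<rbrakk> \<Longrightarrow>
      0 \<le> m ({0..<k - r} \<union> {i..<i + r}) ({0..<k - r'} \<union> {j..<j + r'})"
    and strict: "\<And>r i r' j. \<lbrakk>r \<in> {1..k}; k - r \<le> i; r' \<in> {1..k}; k - r' \<le> j; j + r' \<le> n;
      r' < k \<or> j = 0\<rbrakk> \<Longrightarrow> 0 < m ({0..<k - r} \<union> {i..<i + r}) ({0..<k - r'} \<union> {j..<j + r'})"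
    and \<alpha>: "finite \<alpha>" "card \<alpha> = k" and \<beta>: "\<beta> \<subseteq> {0..<n}" "card \<beta> = k"
  shows "0 \<in> \<beta> \<Longrightarrow> 0 < m \<alpha> \<beta>" and "0 \<le> m \<alpha> \<beta>"
proof -
  let ?init = "\<lambda>r i. {0..<k - r} \<union> {i..<i + r}"
  have card_init: "card (?init r i) = k" if "r \<le> k" "k - r \<le> i" for r i
    using that by (subst card_Un_disjoint) auto
  have init_strict: "0 < m (?init r i) \<gamma>"
    if ri: "r \<in> {1..k}" "k - r \<le> i" and \<gamma>: "\<gamma> \<subseteq> {0..<n}" "card \<gamma> = k" "0 \<in> \<gamma>" for r i \<gamma>
  proof -
    let ?p = "\<lambda>\<gamma>. m (?init r i) \<gamma>"
    have "length (sorted_elems (?init r i)) = k" using card_init ri by simp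
    then have "pluecker_relations {0..<n} k
        (\<lambda>\<gamma>. \<sigma> * minor (\<lambda>a b. h b a) (sorted_elems \<gamma>) (sorted_elems (?init r i)))"
      using pluecker_relations_minor[of "{0..<n}" "sorted_elems (?init r i)" \<sigma> "\<lambda>a b. h b a"] by simp
    then have pl: "pluecker_relations {0..<n} (Suc (k - 1))
        (\<lambda>\<gamma>. \<sigma> * minor (\<lambda>a b. h b a) (sorted_elems \<gamma>) (sorted_elems (?init r i)))"
      using k by simp
    have tr: "\<sigma> * minor (\<lambda>a b. h b a) (sorted_elems \<gamma>) (sorted_elems (?init r i)) = ?p \<gamma>"
      if "card \<gamma> = k" for \<gamma>
      using that card_init[of r i] ri unfolding m_def by (subst minor_transpose) auto
    have "0 < \<sigma> * minor (\<lambda>a b. h b a) (sorted_elems (insert 0 (\<gamma> - {0}))) (sorted_elems (?init r i))"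
    proof (rule positivity_from_initial_sets[where a = 1 and L = n and k = "k - 1" and \<alpha> = "\<gamma> - {0}"
        and p = "\<lambda>\<gamma>. \<sigma> * minor (\<lambda>a b. h b a) (sorted_elems (insert 0 \<gamma>)) (sorted_elems (?init r i))"])
      have "{0..<n} - {0} = {1..<n}" by auto
      then show "pluecker_relations {1..<n} (k - 1)
          (\<lambda>\<gamma>. \<sigma> * minor (\<lambda>a b. h b a) (sorted_elems (insert 0 \<gamma>)) (sorted_elems (?init r i)))"
        using pluecker_relations_contract[OF pl, of 0] k by simp
      fix r' s assume rs: "r' \<le> k - 1" "1 + (k - 1 - r') \<le> s" "s + r' \<le> n"
      have eq: "insert 0 ({1..<1 + (k - 1 - r')} \<union> {s..<s + r'}) = ?init r' s"
        using rs k by auto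
      have "0 < m (?init r i) (?init r' s)"
      proof (cases "r' = 0")
        case True
        then have "?init r' s = ?init k 0" by simp
        then show ?thesis using strict[of r i k 0] ri k by simp
      next
        case False
        then show ?thesis using rs k by (intro strict ri) auto
      qed
      then show "0 < \<sigma> * minor (\<lambda>a b. h b a)
          (sorted_elems (insert 0 ({1..<1 + (k - 1 - r')} \<union> {s..<s + r'}))) (sorted_elems (?init r i))"
        using card_init[of r' s] rs k by (subst tr) (auto simp only: eq)
    qed (use \<gamma> k in auto)
    then show ?thesis using \<gamma> by (simp only: insert_Diff tr)
  qed
  have init_weak: "0 \<le> m (?init r i) \<gamma>"
    if ri: "r \<in> {1..k}" "k - r \<le> i" and \<gamma>: "\<gamma> \<subseteq> {0..<n}" "card \<gamma> = k" for r i \<gamma>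
  proof -
    have tr: "\<sigma> * minor (\<lambda>a b. h b a) (sorted_elems \<gamma>) (sorted_elems (?init r i)) = m (?init r i) \<gamma>"
      if "card \<gamma> = k" for \<gamma>
      using that card_init[of r i] ri unfolding m_def by (subst minor_transpose) auto
    have len: "length (sorted_elems (?init r i)) = k" using card_init ri by simp
    have "0 \<le> \<sigma> * minor (\<lambda>a b. h b a) (sorted_elems \<gamma>) (sorted_elems (?init r i))"
    proof (rule positivity_from_intervals[where a = 0 and L = n and k = k and Q = "\<lambda>x. 0 \<le> x"
        and \<alpha> = \<gamma> and p = "\<lambda>\<gamma>. \<sigma> * minor (\<lambda>a b. h b a) (sorted_elems \<gamma>) (sorted_elems (?init r i))"])
      show "pluecker_relations {0..<n} k
          (\<lambda>\<gamma>. \<sigma> * minor (\<lambda>a b. h b a) (sorted_elems \<gamma>) (sorted_elems (?init r i)))"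
        using pluecker_relations_minor[of "{0..<n}" "sorted_elems (?init r i)" \<sigma> "\<lambda>a b. h b a"] len
        by simp
    next
      fix \<gamma>' assume "\<gamma>' \<subseteq> {0..<n}" "card \<gamma>' = k" "0 \<in> \<gamma>'"
      then show "0 < \<sigma> * minor (\<lambda>a b. h b a) (sorted_elems \<gamma>') (sorted_elems (?init r i))"
        using init_strict[OF ri] tr by simp
    next
      fix s assume "s + k \<le> n"
      then have "0 \<le> m (?init r i) (?init k s)" using weak[of r i k s] ri k by simp
      then show "0 \<le> \<sigma> * minor (\<lambda>a b. h b a) (sorted_elems {s..<s + k}) (sorted_elems (?init r i))"
        by (subst tr) auto
    qed (use \<gamma> k in auto)
    then show ?thesis using tr[OF \<gamma>(2)] by simp
  qed
  obtain L where L: "\<alpha> \<subseteq> {0..<L}" using finite_nat_iff_bounded[of \<alpha>] \<alpha>(1) by (auto simp: atLeast0LessThan)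
  have rows: "0 < \<sigma> * minor h' (sorted_elems \<alpha>) cs"
    if "length cs = k" and pos: "\<And>r i. r \<in> {1..k} \<Longrightarrow> k - r \<le> i \<Longrightarrow>
      0 < \<sigma> * minor h' (sorted_elems (?init r i)) cs" for h' cs
  proof (rule positivity_from_initial_sets[where a = 0 and L = L and k = k
        and p = "\<lambda>\<alpha>. \<sigma> * minor h' (sorted_elems \<alpha>) cs"])
    show "pluecker_relations {0..<L} k (\<lambda>\<alpha>. \<sigma> * minor h' (sorted_elems \<alpha>) cs)"
      using pluecker_relations_minor[of "{0..<L}" cs \<sigma> h'] \<open>length cs = k\<close> by simp
    fix r s assume rs: "r \<le> k" "0 + (k - r) \<le> s"
    show "0 < \<sigma> * minor h' (sorted_elems ({0..<0 + (k - r)} \<union> {s..<s + r})) cs"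
    proof (cases "r = 0")
      case True
      then show ?thesis using pos[of k 0] k by simp
    next
      case False
      then show ?thesis using pos[of r s] rs by simp
    qed
  qed (use \<alpha> L in auto)
  show pos: "0 < m \<alpha> \<beta>" if "0 \<in> \<beta>"
    unfolding m_def
    by (rule rows) (use \<beta> that init_strict in \<open>auto simp: m_def\<close>)
  show "0 \<le> m \<alpha> \<beta>"
  proof (cases "0 \<in> \<beta>")
    case False
    have fin: "finite \<beta>" "\<beta> \<noteq> {}" using \<beta> k finite_subset by (auto intro: finite_subset)
    define b \<gamma> where "b = Min \<beta>" and "\<gamma> = \<beta> - {b}"
    have "b \<in> \<beta>" "b \<notin> \<gamma>" using fin by (auto simp: b_def \<gamma>_def)
    then have "b \<noteq> 0" using False by metis
    have sb: "sorted_elems \<beta> = b # sorted_elems \<gamma>"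
      unfolding b_def \<gamma>_def by (rule sorted_list_of_set_nonempty[OF fin])
    have "0 \<notin> \<gamma>" "finite \<gamma>" using False fin by (auto simp: \<gamma>_def)
    then have "{s \<in> \<gamma>. s < 0} = {}" "{s \<in> \<gamma>. 0 < s} = \<gamma>" by (auto intro: gr0I)
    then have s0: "sorted_elems (insert 0 \<gamma>) = 0 # sorted_elems \<gamma>"
      using sorted_elems_insert[of \<gamma> 0] \<open>0 \<notin> \<gamma>\<close> \<open>finite \<gamma>\<close> by simp
    have card_\<gamma>: "card \<gamma> = k - 1" using \<beta>(2) \<open>b \<in> \<beta>\<close> fin by (simp add: \<gamma>_def)
    have \<gamma>0: "insert 0 \<gamma> \<subseteq> {0..<n}" "card (insert 0 \<gamma>) = k"
      using \<beta> k card_\<gamma> \<open>0 \<notin> \<gamma>\<close> \<open>finite \<gamma>\<close> by (auto simp: \<gamma>_def)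
    have lin: "minor (\<lambda>i j. h i j + (if j = b then \<epsilon> * h i 0 else 0)) rs (sorted_elems \<beta>) =
        minor h rs (sorted_elems \<beta>) + \<epsilon> * minor h rs (sorted_elems (insert 0 \<gamma>))"
      if len: "length rs = k" for rs \<epsilon>
    proof -
      have len': "length rs = Suc (length (sorted_elems \<gamma>))" using that card_\<gamma> k by simp
      obtain C where C: "\<And>Y a. (\<And>r c. r \<in> set (sorted_elems \<gamma>) \<Longrightarrow> Y r c = h c r) \<Longrightarrow>
          minor Y (a # sorted_elems \<gamma>) rs = (\<Sum>j<length rs. Y a (rs ! j) * C j)"
        using minor_expand_row[OF len', of "\<lambda>a b. h b a"] by blast
      have tr: "minor Y rs (a # sorted_elems \<gamma>) = minor (\<lambda>i j. Y j i) (a # sorted_elems \<gamma>) rs"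
        for Y :: "nat \<Rightarrow> nat \<Rightarrow> real" and a
        using minor_transpose[of "a # sorted_elems \<gamma>" rs "\<lambda>i j. Y j i"] len' by simp
      have "minor (\<lambda>j i. h i j + (if j = b then \<epsilon> * h i 0 else 0)) (b # sorted_elems \<gamma>) rs =
          (\<Sum>j<length rs. (h (rs ! j) b + \<epsilon> * h (rs ! j) 0) * C j)"
        by (subst C) (use \<open>b \<notin> \<gamma>\<close> \<open>finite \<gamma>\<close> in auto)
      moreover have "minor (\<lambda>j i. h i j) (a # sorted_elems \<gamma>) rs = (\<Sum>j<length rs. h (rs ! j) a * C j)"
        for a by (subst C) auto
      ultimately show ?thesis
        unfolding sb s0 tr by (simp add: algebra_simps sum.distrib sum_distrib_left)
    qed
    \<comment> \<open>The number \<open>\<epsilon>\<close> need not be small: positivity for every \<open>\<epsilon> > 0\<close> gives the limit.\<close>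
    have perturbed: "0 < m \<alpha> \<beta> + \<epsilon> * m \<alpha> (insert 0 \<gamma>)" if "0 < \<epsilon>" for \<epsilon>
    proof -
      have "0 < \<sigma> * minor (\<lambda>i j. h i j + (if j = b then \<epsilon> * h i 0 else 0))
          (sorted_elems \<alpha>) (sorted_elems \<beta>)"
      proof (rule rows)
        fix r i assume ri: "r \<in> {1..k}" "k - r \<le> i"
        have "0 < m (?init r i) \<beta> + \<epsilon> * m (?init r i) (insert 0 \<gamma>)"
          using init_weak[OF ri \<beta>] init_strict[OF ri \<gamma>0] that by (simp add: add_nonneg_pos)
        then show "0 < \<sigma> * minor (\<lambda>i j. h i j + (if j = b then \<epsilon> * h i 0 else 0))
            (sorted_elems (?init r i)) (sorted_elems \<beta>)"
          using card_init[of r i] ri by (subst lin) (auto simp: m_def algebra_simps)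
      qed (use \<beta> in auto)
      then show ?thesis using \<alpha> by (subst (asm) lin) (auto simp: m_def algebra_simps)
    qed
    have pos0: "0 < m \<alpha> (insert 0 \<gamma>)"
      unfolding m_def by (rule rows) (use \<gamma>0 init_strict in \<open>auto simp: m_def\<close>)
    show ?thesis
    proof (rule ccontr)
      assume neg: "\<not> 0 \<le> m \<alpha> \<beta>"
      then have "0 < - m \<alpha> \<beta> / m \<alpha> (insert 0 \<gamma>)" using pos0 by (simp add: divide_neg_pos)
      from perturbed[OF this] show False using pos0 by simp
    qed
  qed (use pos in auto)
qed

section \<open>The Cauchy--Binet formula\<close>

text \<open>Every row of the product is a combination of rows of \<open>Y\<close>; this is the expansion by multilinearity, with
\<open>f\<close> choosing a row of \<open>Y\<close> for every row of the product. Outside \<open>{0..<k}\<close> the functions are fixed to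
be the identity so that there are finitely many.\<close>

lemma minor_sum_rows:
  assumes len: "length rs = k" "length cs = k"
  shows "minor (\<lambda>i j. \<Sum>l<n. X i l * Y l j) rs cs =
    (\<Sum>f | (\<forall>i\<in>{0..<k}. f i \<in> {0..<n}) \<and> (\<forall>i. i \<notin> {0..<k} \<longrightarrow> f i = i).
       (\<Prod>i<k. X (rs ! i) (f i)) * minor Y (map f [0..<k]) cs)"
proof -
  let ?y = "\<lambda>l. vec k (\<lambda>j. Y l (cs ! j))"
  have "minor (\<lambda>i j. \<Sum>l<n. X i l * Y l j) rs cs =
      det (mat\<^sub>r k k (\<lambda>i. finsum_vec TYPE('a) k (\<lambda>l. X (rs ! i) l \<cdot>\<^sub>v ?y l) {0..<n}))"
    unfolding minor_def
  proof (rule arg_cong[where f = det], rule eq_matI)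
    fix i j assume "i < dim_row (mat\<^sub>r k k (\<lambda>i. finsum_vec TYPE('a) k (\<lambda>l. X (rs ! i) l \<cdot>\<^sub>v ?y l) {0..<n}))"
      "j < dim_col (mat\<^sub>r k k (\<lambda>i. finsum_vec TYPE('a) k (\<lambda>l. X (rs ! i) l \<cdot>\<^sub>v ?y l) {0..<n}))"
    then have ij: "i < k" "j < k" by auto
    have "finsum_vec TYPE('a) k (\<lambda>l. X (rs ! i) l \<cdot>\<^sub>v ?y l) {0..<n} $ j = (\<Sum>l<n. X (rs ! i) l * Y l (cs ! j))"
      using ij by (subst index_finsum_vec) (auto simp: atLeast0LessThan)
    then show "mat (length rs) (length cs) (\<lambda>(i, j). \<Sum>l<n. X (rs ! i) l * Y l (cs ! j)) $$ (i, j) =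
      mat\<^sub>r k k (\<lambda>i. finsum_vec TYPE('a) k (\<lambda>l. X (rs ! i) l \<cdot>\<^sub>v ?y l) {0..<n}) $$ (i, j)"
      using ij len by simp
  qed (use len in auto)
  also have "\<dots> = (\<Sum>f | (\<forall>i\<in>{0..<k}. f i \<in> {0..<n}) \<and> (\<forall>i. i \<notin> {0..<k} \<longrightarrow> f i = i).
       det (mat\<^sub>r k k (\<lambda>i. X (rs ! i) (f i) \<cdot>\<^sub>v ?y (f i))))"
    by (rule det_linear_rows_sum) auto
  also have "\<dots> = (\<Sum>f | (\<forall>i\<in>{0..<k}. f i \<in> {0..<n}) \<and> (\<forall>i. i \<notin> {0..<k} \<longrightarrow> f i = i).
       (\<Prod>i<k. X (rs ! i) (f i)) * minor Y (map f [0..<k]) cs)"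
  proof (rule sum.cong[OF refl])
    fix f :: "nat \<Rightarrow> nat"
    have "mat\<^sub>r k k (\<lambda>i. ?y (f i)) = mat k k (\<lambda>(i, j). Y (f i) (cs ! j))"
      by (rule eq_matI) auto
    also have "\<dots> = mat (length (map f [0..<k])) (length cs) (\<lambda>(i, j). Y (map f [0..<k] ! i) (cs ! j))"
      by (rule eq_matI) (use len in auto)
    finally show "det (mat\<^sub>r k k (\<lambda>i. X (rs ! i) (f i) \<cdot>\<^sub>v ?y (f i))) =
        (\<Prod>i<k. X (rs ! i) (f i)) * minor Y (map f [0..<k]) cs"
      by (subst det_rows_mul) (auto simp: minor_def atLeast0LessThan)
  qed
  finally show ?thesis .
qed

lemma minor_permute_rows:
  assumes "length rs = k" "length cs = k" "\<pi> permutes {0..<k}"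
  shows "minor Y (map (\<lambda>i. rs ! \<pi> i) [0..<k]) cs = signof \<pi> * minor Y rs cs"
proof -
  let ?M = "mat k k (\<lambda>(i, j). Y (rs ! i) (cs ! j))"
  have "\<pi> i < k" if "i < k" for i using permutes_in_image[OF assms(3), of i] that by simp
  then have "mat k k (\<lambda>(i, j). Y (map (\<lambda>i. rs ! \<pi> i) [0..<k] ! i) (cs ! j)) =
      mat k k (\<lambda>(i, j). ?M $$ (\<pi> i, j))"
    by (intro eq_matI) auto
  then show ?thesis
    using det_permute_rows[OF _ assms(3), of ?M] assms(1,2) by (simp add: minor_def)
qed

text \<open>In the expansion by multilinearity the non-injective choices vanish. The injective ones with image \<open>\<gamma>\<close> are
the permutations of \<open>\<gamma>\<close>, and summing over these gives the determinant of the columns \<open>\<gamma>\<close> of \<open>X\<close>.\<close>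

theorem Cauchy_Binet:
  assumes len: "length rs = k" "length cs = k"
  shows "minor (\<lambda>i j. \<Sum>l<n. X i l * Y l j) rs cs =
    (\<Sum>\<gamma> | \<gamma> \<subseteq> {0..<n} \<and> card \<gamma> = k. minor X rs (sorted_elems \<gamma>) * minor Y (sorted_elems \<gamma>) cs)"
proof -
  let ?K = "{0..<k}"
  define F where "F = {f. (\<forall>i\<in>?K. f i \<in> {0..<n}) \<and> (\<forall>i. i \<notin> ?K \<longrightarrow> f i = i)}"
  define G where "G = {\<gamma>. \<gamma> \<subseteq> {0..<n} \<and> card \<gamma> = k}"
  let ?t = "\<lambda>f. (\<Prod>i<k. X (rs ! i) (f i)) * minor Y (map f [0..<k]) cs"
  have finG: "finite G" unfolding G_def by simp
  have finF: "finite F"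
    unfolding F_def by (rule finite_bounded_functions) auto
  have fiber: "(\<Sum>f | f \<in> F \<and> f ` ?K = \<gamma>. ?t f) = minor X rs (sorted_elems \<gamma>) * minor Y (sorted_elems \<gamma>) cs"
    if \<gamma>: "\<gamma> \<in> G" for \<gamma>
  proof -
    have fin: "finite \<gamma>" using \<gamma> by (auto simp: G_def intro: finite_subset)
    define e where "e = (\<lambda>i. sorted_elems \<gamma> ! i)"
    have len\<gamma>: "length (sorted_elems \<gamma>) = k" using \<gamma> by (simp add: G_def)
    have e: "bij_betw e ?K \<gamma>"
      using bij_betw_nth[of "sorted_elems \<gamma>" ?K \<gamma>] fin len\<gamma> by (simp add: e_def atLeast0LessThan)
    let ?to = "\<lambda>\<pi> i. if i < k then e (\<pi> i) else i"
    let ?from = "\<lambda>f i. if i < k then inv_into ?K e (f i) else i"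
    have "(\<Sum>f | f \<in> F \<and> f ` ?K = \<gamma>. ?t f) = (\<Sum>\<pi> | \<pi> permutes ?K. ?t (?to \<pi>))"
    proof (rule sum.reindex_bij_witness[of _ ?to ?from])
      fix f assume "f \<in> {f. f \<in> F \<and> f ` ?K = \<gamma>}"
      then have f: "f \<in> F" "f ` ?K = \<gamma>" by auto
      have e_inv: "e (inv_into ?K e (f i)) = f i" if "i < k" for i
        using that f e by (intro f_inv_into_f) (auto simp: bij_betw_def)
      show to_from: "?to (?from f) = f"
        using e_inv f(1) by (auto simp: F_def)
      show "?t (?to (?from f)) = ?t f" by (rule arg_cong[where f = ?t, OF to_from])
      have "bij_betw f ?K \<gamma>"
        using f(2) \<gamma> by (simp add: bij_betw_def eq_card_imp_inj_on G_def)
      then have "bij_betw (inv_into ?K e \<circ> f) ?K ?K"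
        using bij_betw_inv_into[OF e] by (rule bij_betw_trans)
      then have "bij_betw (?from f) ?K ?K"
        by (subst bij_betw_cong[where g = "inv_into ?K e \<circ> f"]) auto
      then show "?from f \<in> {\<pi>. \<pi> permutes ?K}"
        by (auto intro!: bij_imp_permutes)
    next
      fix \<pi> assume "\<pi> \<in> {\<pi>. \<pi> permutes ?K}"
      then have \<pi>: "\<pi> permutes ?K" by simp
      have lt: "\<pi> i < k" if "i < k" for i using permutes_in_image[OF \<pi>, of i] that by simp
      have "inv_into ?K e (e (\<pi> i)) = \<pi> i" if "i < k" for i
        using e lt[OF that] by (intro inv_into_f_f) (auto simp: bij_betw_def)
      moreover have "\<pi> i = i" if "\<not> i < k" for i using permutes_not_in[OF \<pi>, of i] that by simp
      ultimately show "?from (?to \<pi>) = \<pi>" by auto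
      have im: "?to \<pi> ` ?K = \<gamma>"
      proof -
        have "?to \<pi> ` ?K = e ` \<pi> ` ?K" unfolding image_image by (rule image_cong) auto
        also have "\<dots> = \<gamma>" using permutes_image[OF \<pi>] e by (simp add: bij_betw_def)
        finally show ?thesis .
      qed
      then have "?to \<pi> i \<in> {0..<n}" if "i \<in> ?K" for i
        using that \<gamma> unfolding G_def by blast
      then show "?to \<pi> \<in> {f. f \<in> F \<and> f ` ?K = \<gamma>}"
        using im by (auto simp: F_def)
    qed
    also have "\<dots> = (\<Sum>\<pi> | \<pi> permutes ?K. (\<Prod>i<k. X (rs ! i) (sorted_elems \<gamma> ! \<pi> i)) *
        (signof \<pi> * minor Y (sorted_elems \<gamma>) cs))"
    proof (rule sum.cong[OF refl])
      fix \<pi> assume "\<pi> \<in> {\<pi>. \<pi> permutes ?K}"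
      then have \<pi>: "\<pi> permutes ?K" by simp
      have "map (?to \<pi>) [0..<k] = map (\<lambda>i. sorted_elems \<gamma> ! \<pi> i) [0..<k]"
        by (simp add: e_def)
      then have "minor Y (map (?to \<pi>) [0..<k]) cs = signof \<pi> * minor Y (sorted_elems \<gamma>) cs"
        using minor_permute_rows[OF len\<gamma> len(2) \<pi>, of Y] by (simp only:)
      moreover have "(\<Prod>i<k. X (rs ! i) (?to \<pi> i)) = (\<Prod>i<k. X (rs ! i) (sorted_elems \<gamma> ! \<pi> i))"
        by (rule prod.cong) (simp_all add: e_def)
      ultimately show "?t (?to \<pi>) = (\<Prod>i<k. X (rs ! i) (sorted_elems \<gamma> ! \<pi> i)) *
          (signof \<pi> * minor Y (sorted_elems \<gamma>) cs)"
        by (simp only:)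
    qed
    also have "\<dots> = (\<Sum>\<pi> | \<pi> permutes ?K. signof \<pi> * (\<Prod>i<k. X (rs ! i) (sorted_elems \<gamma> ! \<pi> i))) *
        minor Y (sorted_elems \<gamma>) cs"
      unfolding sum_distrib_right by (intro sum.cong refl) (simp add: ac_simps)
    also have "(\<Sum>\<pi> | \<pi> permutes ?K. signof \<pi> * (\<Prod>i<k. X (rs ! i) (sorted_elems \<gamma> ! \<pi> i))) =
        minor X rs (sorted_elems \<gamma>)"
    proof -
      have "\<pi> i < k" if "\<pi> permutes ?K" "i < k" for \<pi> i
        using permutes_in_image[OF that(1), of i] that by simp
      then show ?thesis
        unfolding minor_def by (subst det_def'[of _ k])
          (use len len\<gamma> in \<open>auto intro!: sum.cong prod.cong simp: atLeast0LessThan\<close>)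
    qed
    finally show ?thesis .
  qed
  have "minor (\<lambda>i j. \<Sum>l<n. X i l * Y l j) rs cs = (\<Sum>f\<in>F. ?t f)"
    unfolding F_def by (rule minor_sum_rows[OF len])
  also have "\<dots> = (\<Sum>f | f \<in> F \<and> f ` ?K \<in> G. ?t f)"
  proof (rule sum.mono_neutral_right[OF finF])
    show "\<forall>f\<in>F - {f. f \<in> F \<and> f ` ?K \<in> G}. ?t f = 0"
    proof
      fix f assume "f \<in> F - {f. f \<in> F \<and> f ` ?K \<in> G}"
      then have "card (f ` ?K) \<noteq> k" by (auto simp: F_def G_def)
      then have "\<not> inj_on f ?K" using card_image by fastforce
      then have "minor Y (map f [0..<k]) cs = 0"
        using len by (intro minor_repeated_row) (auto simp: distinct_map)
      then show "?t f = 0" by simp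
    qed
  qed auto
  also have "\<dots> = (\<Sum>\<gamma>\<in>G. \<Sum>f | f \<in> {f. f \<in> F \<and> f ` ?K \<in> G} \<and> f ` ?K = \<gamma>. ?t f)"
    by (rule sum.group[symmetric]) (use finF finG in auto)
  also have "\<dots> = (\<Sum>\<gamma>\<in>G. minor X rs (sorted_elems \<gamma>) * minor Y (sorted_elems \<gamma>) cs)"
  proof (rule sum.cong[OF refl])
    fix \<gamma> assume \<gamma>: "\<gamma> \<in> G"
    then have "{f. f \<in> {f. f \<in> F \<and> f ` ?K \<in> G} \<and> f ` ?K = \<gamma>} = {f. f \<in> F \<and> f ` ?K = \<gamma>}" by auto
    then show "(\<Sum>f | f \<in> {f. f \<in> F \<and> f ` ?K \<in> G} \<and> f ` ?K = \<gamma>. ?t f) =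
        minor X rs (sorted_elems \<gamma>) * minor Y (sorted_elems \<gamma>) cs"
      using fiber[OF \<gamma>] by (simp only:)
  qed
  finally show ?thesis unfolding G_def .
qed

section \<open>Variation bounding from the signs of the minors\<close>

text \<open>Induction along the nonzero entries: passing from one nonzero entry to the next adds at most one sign
change, and if it adds one, the new entry extends the chain. The last clause records the sign at the end
of the chain, which is needed for this.\<close>

lemma alternating_chain_below:
  fixes y :: "nat \<Rightarrow> real"
  assumes "y b \<noteq> 0" "N = card {(i, j) \<in> sign_changes UNIV y. j \<le> b}"
  obtains f where "\<And>m. m < N \<Longrightarrow> f m < f (Suc m)" "\<And>m. m < N \<Longrightarrow> y (f m) * y (f (Suc m)) < 0"
    "f N \<le> b" "0 < y (f N) * y b"
  using assms
proof (induction b arbitrary: N thesis rule: less_induct)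
  case (less b)
  let ?sc = "\<lambda>b. {(i, j) \<in> sign_changes UNIV y. j \<le> b}"
  let ?P = "{i. i < b \<and> y i \<noteq> 0}"
  show ?case
  proof (cases "?P = {}")
    case True
    have "?sc b = {}"
    proof (rule ccontr)
      assume "?sc b \<noteq> {}"
      then obtain i j where "(i, j) \<in> sign_changes UNIV y" "j \<le> b" by auto
      then have "i \<in> ?P" by (auto simp: sign_changes_def)
      then show False using True by blast
    qed
    then have "N = 0" using less.prems(3) by (simp only: card.empty)
    then show ?thesis
      using less.prems(1)[of "\<lambda>_. b"] less.prems(2) by (auto simp: zero_less_mult_iff linorder_neq_iff)
  next
    case False
    define p where "p = Max ?P"
    have p: "p < b" "y p \<noteq> 0" and maximal: "\<And>i. i < b \<Longrightarrow> y i \<noteq> 0 \<Longrightarrow> i \<le> p"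
      using Max_in[of ?P] False unfolding p_def by auto
    have "finite (?sc p)"
      by (rule finite_subset[of _ "{..p} \<times> {..p}"]) (auto simp: sign_changes_def)
    obtain f where f: "\<And>m. m < card (?sc p) \<Longrightarrow> f m < f (Suc m)"
        "\<And>m. m < card (?sc p) \<Longrightarrow> y (f m) * y (f (Suc m)) < 0"
        "f (card (?sc p)) \<le> p" "0 < y (f (card (?sc p))) * y p"
      using less.IH[OF p(1) _ p(2) refl] by blast
    have step: "?sc b = ?sc p \<union> {(i, j). i = p \<and> j = b \<and> y p * y b < 0}"
    proof -
      have "(i, j) \<in> ?sc p \<or> i = p \<and> j = b \<and> y p * y b < 0" if ij: "(i, j) \<in> ?sc b" for i j
      proof (cases "j = b")
        case True
        have "i < b" "y i \<noteq> 0" "y i * y b < 0" "i < p \<Longrightarrow> y p = 0"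
          using ij True p(1) by (auto simp: sign_changes_def)
        then have "\<not> i < p" "i \<le> p" using maximal[of i] p(2) by blast+
        then have "i = p" by simp
        then show ?thesis using True \<open>y i * y b < 0\<close> by simp
      next
        case False
        then have "j < b" "y j \<noteq> 0" using ij by (auto simp: sign_changes_def)
        then have "j \<le> p" by (rule maximal)
        then show ?thesis using ij by simp
      qed
      moreover have "(p, b) \<in> sign_changes UNIV y" if "y p * y b < 0"
        using that p maximal by (force simp: sign_changes_def)
      ultimately show ?thesis using p(1) by auto
    qed
    show ?thesis
    proof (cases "y p * y b < 0")
      case True
      then have "?sc b = insert (p, b) (?sc p)" using step by auto
      then have N: "N = Suc (card (?sc p))"
        using less.prems(3) p(1) \<open>finite (?sc p)\<close> by simp
      have "y (f (card (?sc p))) * y b < 0"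
        using f(4) True by (auto simp: mult_less_0_iff zero_less_mult_iff)
      then show ?thesis
        using f p less.prems(2)
        by (intro less.prems(1)[of "f(N := b)"])
          (auto simp: N less_Suc_eq zero_less_mult_iff linorder_neq_iff)
    next
      case False
      then have "?sc b = ?sc p" using step by auto
      then have "N = card (?sc p)" using less.prems(3) by simp
      moreover have "0 < y p * y b" using False p(2) less.prems(2) by (auto simp: not_less less_le)
      then have "0 < y (f (card (?sc p))) * y b"
        using f(4) by (auto simp: zero_less_mult_iff)
      ultimately show ?thesis using f p by (intro less.prems(1)[of f]) auto
    qed
  qed
qed

lemma alternating_chain:
  fixes y :: "nat \<Rightarrow> real"
  assumes "\<not> variation UNIV y \<le> ereal (real (k - 1))" "1 \<le> k"
  obtains f where "\<And>m. m < k \<Longrightarrow> f m < f (Suc m)" "\<And>m. m < k \<Longrightarrow> y (f m) * y (f (Suc m)) < 0"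
proof -
  let ?S = "sign_changes UNIV y"
  obtain F where F: "F \<subseteq> ?S" "finite F" "card F = k"
  proof (cases "finite ?S")
    case True
    then have "k - 1 < card ?S"
      using assms by (auto simp: variation_def one_ereal_def split: if_splits)
    then have "k \<le> card ?S" by simp
    then show ?thesis using that obtain_subset_with_card_n by metis
  next
    case False
    then show ?thesis using that infinite_arbitrarily_large by blast
  qed
  have "F \<noteq> {}" using F(3) assms(2) by auto
  define b where "b = Max (snd ` F)"
  have "b \<in> snd ` F" unfolding b_def using F(2) \<open>F \<noteq> {}\<close> by simp
  then have "y b \<noteq> 0" using F(1) by (auto simp: sign_changes_def)
  let ?C = "{(i, j) \<in> ?S. j \<le> b}"
  have "finite ?C"
    by (rule finite_subset[of _ "{..b} \<times> {..b}"]) (auto simp: sign_changes_def)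
  moreover have "F \<subseteq> ?C" using F(1,2) by (auto simp: b_def intro!: Max_ge image_eqI)
  ultimately have "k \<le> card ?C" using F(3) card_mono[of ?C F] by simp
  obtain f where f: "\<And>m. m < card ?C \<Longrightarrow> f m < f (Suc m)"
      "\<And>m. m < card ?C \<Longrightarrow> y (f m) * y (f (Suc m)) < 0" "f (card ?C) \<le> b" "0 < y (f (card ?C)) * y b"
    by (rule alternating_chain_below[of y b "card ?C", OF \<open>y b \<noteq> 0\<close> refl]) (rule that)
  show ?thesis
    by (rule that[of f]; rule f) (use \<open>k \<le> card ?C\<close> in auto)
qed

text \<open>Zero entries take the sign of the preceding nonzero entry; \<open>s\<close> is used for the zeros at the start.\<close>

primrec sign_pattern :: "real \<Rightarrow> (nat \<Rightarrow> real) \<Rightarrow> nat \<Rightarrow> real" where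
  "sign_pattern s u 0 = (if u 0 = 0 then s else sgn (u 0))"
| "sign_pattern s u (Suc i) = (if u (Suc i) = 0 then sign_pattern s u i else sgn (u (Suc i)))"

text \<open>For the zeros at the start, \<open>s\<close> is taken to be the sign of the first nonzero entry, so that no sign change
is created there. Whenever the filled pattern changes from \<open>i\<close> to \<open>Suc i\<close>, the position \<open>Suc i\<close> is the
right end of a sign change of \<open>u\<close>.\<close>

lemma exists_sign_pattern:
  fixes u :: "nat \<Rightarrow> real"
  assumes var: "variation {..<n} u \<le> ereal (real (k - 1))" and nz: "\<exists>i<n. u i \<noteq> 0"
  obtains \<sigma> where "\<And>i. i < n \<Longrightarrow> \<bar>\<sigma> i\<bar> = 1" "\<And>i. i < n \<Longrightarrow> 0 \<le> u i * \<sigma> i"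
    "card {i. Suc i < n \<and> \<sigma> i \<noteq> \<sigma> (Suc i)} \<le> k - 1"
proof -
  define p where "p = (LEAST i. u i \<noteq> 0)"
  have "\<exists>i. u i \<noteq> 0" using nz by blast
  then have "u p \<noteq> 0" unfolding p_def by (rule LeastI_ex)
  moreover have "u i = 0" if "i < p" for i
    using not_less_Least[of i "\<lambda>i. u i \<noteq> 0"] that by (simp add: p_def)
  ultimately have p: "u p \<noteq> 0" "\<And>i. i < p \<Longrightarrow> u i = 0" by blast+
  define \<sigma> where "\<sigma> = sign_pattern (sgn (u p)) u"
  have source: "\<exists>j. u j \<noteq> 0 \<and> \<sigma> i = sgn (u j) \<and> (\<forall>l\<le>i. u l \<noteq> 0 \<longrightarrow> l \<le> j) \<and> (i < j \<longrightarrow> j = p)" for i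
  proof (induction i)
    case 0
    show ?case
      by (rule exI[of _ p]) (use p in \<open>auto simp: \<sigma>_def\<close>)
  next
    case (Suc i)
    show ?case
    proof (cases "u (Suc i) = 0")
      case True
      obtain j where "u j \<noteq> 0" "\<sigma> i = sgn (u j)" "\<forall>l\<le>i. u l \<noteq> 0 \<longrightarrow> l \<le> j" "i < j \<longrightarrow> j = p"
        using Suc.IH by blast
      then show ?thesis
        using True by (intro exI[of _ j]) (auto simp: \<sigma>_def le_Suc_eq)
    next
      case False
      then show ?thesis by (intro exI[of _ "Suc i"]) (auto simp: \<sigma>_def)
    qed
  qed
  show ?thesis
  proof (rule that[of \<sigma>])
    show "\<bar>\<sigma> i\<bar> = 1" for i
      using source[of i] by (auto simp: sgn_if)
    show "0 \<le> u i * \<sigma> i" for i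
      by (cases i) (auto simp: \<sigma>_def sgn_if)
    let ?S = "sign_changes {..<n} u" and ?D = "{i. Suc i < n \<and> \<sigma> i \<noteq> \<sigma> (Suc i)}"
    have finS: "finite ?S"
      by (rule finite_subset[of _ "{..<n} \<times> {..<n}"]) (auto simp: sign_changes_def)
    have "Suc ` ?D \<subseteq> snd ` ?S"
    proof
      fix x assume "x \<in> Suc ` ?D"
      then obtain i where i: "x = Suc i" "Suc i < n" "\<sigma> i \<noteq> \<sigma> (Suc i)" by auto
      then have ui: "u (Suc i) \<noteq> 0" "\<sigma> (Suc i) = sgn (u (Suc i))" by (auto simp: \<sigma>_def)
      obtain j where j: "u j \<noteq> 0" "\<sigma> i = sgn (u j)" "\<forall>l\<le>i. u l \<noteq> 0 \<longrightarrow> l \<le> j" "i < j \<longrightarrow> j = p"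
        using source by blast
      have "j \<le> i"
      proof (rule ccontr)
        assume "\<not> j \<le> i"
        then have "j = p" "Suc i \<le> p" using j(4) by auto
        then have "Suc i = p" using p(2)[of "Suc i"] ui(1) by (cases "Suc i = p") auto
        then show False using i(3) j(2) ui(2) \<open>j = p\<close> by simp
      qed
      moreover have "u j * u (Suc i) < 0"
        using i(3) j(1,2) ui by (auto simp: sgn_if mult_less_0_iff split: if_splits)
      moreover have "u l = 0" if "j < l" "l < Suc i" for l
        using j(3) that by (metis less_Suc_eq_le not_less)
      ultimately have "(j, Suc i) \<in> ?S"
        using i by (auto simp: sign_changes_def)
      then show "x \<in> snd ` ?S" using i(1) by force
    qed
    then have "card (Suc ` ?D) \<le> card (snd ` ?S)"
      using finS by (intro card_mono) auto
    also have "\<dots> \<le> card ?S" by (rule card_image_le[OF finS])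
    also have "\<dots> \<le> k - 1"
      using var nz finS by (auto simp: variation_def split: if_splits)
    finally show "card ?D \<le> k - 1" by (simp add: card_image)
  qed
qed

text \<open>The positions where \<open>\<sigma>\<close> changes number at most \<open>k - 1\<close>. Enlarged to a set \<open>D\<close> of exactly \<open>k - 1\<close> cuts, they
divide \<open>{0..<n}\<close> into \<open>k\<close> nonempty blocks; \<open>b i\<close> is the number of the block of \<open>i\<close> and \<open>\<tau> j\<close> the sign on
block \<open>j\<close>.\<close>

lemma exists_blocks:
  fixes \<sigma> :: "nat \<Rightarrow> real"
  assumes "1 \<le> k" "k \<le> n" "card {i. Suc i < n \<and> \<sigma> i \<noteq> \<sigma> (Suc i)} \<le> k - 1"
  obtains b \<tau> where "mono b" "b 0 = 0" "b ` {0..<n} = {0..<k}" "\<And>i. i < n \<Longrightarrow> \<sigma> i = \<tau> (b i)"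
proof -
  let ?D = "{i. Suc i < n \<and> \<sigma> i \<noteq> \<sigma> (Suc i)}"
  obtain D where D: "?D \<subseteq> D" "D \<subseteq> {..<n - 1}" "card D = k - 1"
  proof -
    have "?D \<subseteq> {..<n - 1}" "k - 1 \<le> card {..<n - 1}" using assms(2) by auto
    then show ?thesis using exists_subset_between[of ?D "k - 1" "{..<n - 1}"] assms(3) that by blast
  qed
  have "finite D" using D(2) finite_subset by blast
  define b where "b = (\<lambda>i. card {d \<in> D. d < i})"
  have mono: "mono b"
    unfolding b_def by (intro monoI card_mono) (use \<open>finite D\<close> in auto)
  have b0: "b 0 = 0" by (simp add: b_def)
  have b_Suc: "b (Suc i) = (if i \<in> D then Suc (b i) else b i)" for i
  proof -
    have "{d \<in> D. d < Suc i} = (if i \<in> D then insert i {d \<in> D. d < i} else {d \<in> D. d < i})"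
      by (auto simp: less_Suc_eq)
    then show ?thesis using \<open>finite D\<close> by (simp add: b_def)
  qed
  have "{d \<in> D. d < n - 1} = D" using D(2) by auto
  then have b_last: "b (n - 1) = k - 1" using D(3) by (simp add: b_def)
  have onto: "\<exists>i'\<le>i. b i' = j" if "j \<le> b i" for i j
    using that
  proof (induction i)
    case (Suc i)
    then show ?case by (cases "j \<le> b i") (auto simp: b_Suc le_Suc_eq split: if_splits)
  qed (simp add: b0)
  have range: "b ` {0..<n} = {0..<k}"
  proof
    show "b ` {0..<n} \<subseteq> {0..<k}"
    proof
      fix j assume "j \<in> b ` {0..<n}"
      then obtain i where "i < n" "j = b i" by auto
      then have "j \<le> k - 1" using monoD[OF mono, of i "n - 1"] b_last by simp
      then show "j \<in> {0..<k}" using assms(1) by simp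
    qed
    show "{0..<k} \<subseteq> b ` {0..<n}"
    proof
      fix j assume "j \<in> {0..<k}"
      then have "j \<le> b (n - 1)" using b_last by auto
      then obtain i where "i \<le> n - 1" "b i = j" using onto by blast
      then show "j \<in> b ` {0..<n}" using assms by (intro image_eqI[of _ _ i]) auto
    qed
  qed
  have const: "\<sigma> i = \<sigma> (i + d)" if "b i = b (i + d)" "i + d < n" for i d
    using that
  proof (induction d)
    case (Suc d)
    have "b i \<le> b (i + d)" "b (i + d) \<le> b (i + Suc d)" using monoD[OF mono] by simp_all
    then have eq: "b i = b (i + d)" "b (Suc (i + d)) = b (i + d)" using Suc.prems(1) by simp_all
    then have "i + d \<notin> ?D" using D(1) b_Suc[of "i + d"] by (auto split: if_splits)
    then show ?case using Suc eq(1) by simp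
  qed simp
  have same: "\<sigma> i = \<sigma> i'" if "b i = b i'" "i < n" "i' < n" for i i'
  proof (cases "i \<le> i'")
    case True
    then have "i + (i' - i) = i'" by simp
    then show ?thesis using const[of i "i' - i"] that by (simp only:)
  next
    case False
    then have "i' + (i - i') = i" by simp
    then show ?thesis using const[of i' "i - i'"] that by (simp only:)
  qed
  let ?\<tau> = "\<lambda>j. \<sigma> (SOME i. i < n \<and> b i = j)"
  have "\<sigma> i = ?\<tau> (b i)" if "i < n" for i
  proof -
    have "(SOME i'. i' < n \<and> b i' = b i) < n \<and> b (SOME i'. i' < n \<and> b i' = b i) = b i"
      by (rule someI[of _ i]) (use that in simp)
    then show ?thesis using same that by metis
  qed
  then show ?thesis using that[of b ?\<tau>] mono b0 range by blast
qed

text \<open>The matrix \<open>W\<close> sums weighted columns over blocks. If \<open>\<gamma>\<close> has one element in each block, its rows of \<open>W\<close> form a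
diagonal matrix because \<open>b\<close> is monotone; otherwise some block is missed and its column is zero.\<close>

lemma minor_block_weights:
  fixes w :: "nat \<Rightarrow> real"
  assumes "mono b" "\<gamma> \<subseteq> {0..<n}" "card \<gamma> = k" and w: "\<And>l. l < n \<Longrightarrow> 0 < w l"
  defines "W \<equiv> \<lambda>l j. if b l = j then w l else 0"
  shows "0 \<le> minor W (sorted_elems \<gamma>) [0..<k]"
    and "b ` \<gamma> = {0..<k} \<Longrightarrow> 0 < minor W (sorted_elems \<gamma>) [0..<k]"
proof -
  have fin: "finite \<gamma>" using assms(2) finite_subset by blast
  have len: "length (sorted_elems \<gamma>) = k" using assms(3) by simp
  let ?M = "mat k k (\<lambda>(i, j). W (sorted_elems \<gamma> ! i) j)"
  have M: "minor W (sorted_elems \<gamma>) [0..<k] = det ?M"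
    unfolding minor_def len by (intro arg_cong[where f = det] eq_matI) auto
  show pos: "0 < minor W (sorted_elems \<gamma>) [0..<k]" if onto: "b ` \<gamma> = {0..<k}"
  proof -
    have "inj_on b \<gamma>" using onto assms(3) fin by (intro eq_card_imp_inj_on) auto
    have "map b (sorted_elems \<gamma>) = [0..<k]"
    proof (rule sorted_distinct_set_unique)
      show "sorted (map b (sorted_elems \<gamma>))"
        by (rule sorted_map_mono[OF _ mono_imp_mono_on[OF assms(1)]]) simp
      show "distinct (map b (sorted_elems \<gamma>))"
        using \<open>inj_on b \<gamma>\<close> fin by (simp add: distinct_map)
    qed (use onto fin in auto)
    then have bi: "b (sorted_elems \<gamma> ! i) = i" if "i < k" for i
      using that len by (metis add_0 nth_map nth_upt)
    have "det ?M = prod_list (diag_mat ?M)"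
      by (rule det_lower_triangular[of k]) (use bi in \<open>auto simp: W_def\<close>)
    also have "\<dots> = (\<Prod>i = 0..<k. w (sorted_elems \<gamma> ! i))"
      unfolding prod_list_diag_prod by (rule prod.cong) (use bi in \<open>auto simp: W_def\<close>)
    also have "\<dots> > 0"
    proof (rule prod_pos)
      fix i assume "i \<in> {0..<k}"
      then have "sorted_elems \<gamma> ! i \<in> \<gamma>" using len fin by (metis atLeastLessThan_iff nth_mem set_sorted_list_of_set)
      then show "0 < w (sorted_elems \<gamma> ! i)" using assms(2) by (auto intro!: w)
    qed
    finally show ?thesis unfolding M .
  qed
  show "0 \<le> minor W (sorted_elems \<gamma>) [0..<k]"
  proof (cases "b ` \<gamma> = {0..<k}")
    case False
    have "\<not> {0..<k} \<subseteq> b ` \<gamma>"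
      using False card_seteq[of "b ` \<gamma>" "{0..<k}"] card_image_le[OF fin, of b] fin assms(3)
      by (metis card_atLeastLessThan card_seteq diff_zero finite_imageI)
    then obtain j where j: "j < k" "j \<notin> b ` \<gamma>" by (meson atLeastLessThan_iff subsetI)
    have "det ?M = (\<Sum>i<k. ?M $$ (i, j) * cofactor ?M i j)"
      by (rule laplace_expansion_column) (use j in auto)
    also have "\<dots> = 0"
    proof (intro sum.neutral ballI)
      fix i assume i: "i \<in> {..<k}"
      then have "sorted_elems \<gamma> ! i \<in> \<gamma>" using len fin by (metis lessThan_iff nth_mem set_sorted_list_of_set)
      then have "b (sorted_elems \<gamma> ! i) \<noteq> j" using j(2) by blast
      then show "?M $$ (i, j) * cofactor ?M i j = 0" using i j(1) by (simp add: W_def)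
    qed
    finally show ?thesis unfolding M by simp
  qed (use pos in auto)
qed

text \<open>The minors with a column set containing \<open>0\<close> are assumed nonzero. That makes all \<open>k\<close>-minors of the block
matrix \<open>V = h W\<close> nonzero: in their Cauchy--Binet expansion all terms have the same sign, and a set
of representatives of the blocks that contains \<open>0\<close> contributes strictly.\<close>

theorem variation_bounding_from_minors:
  fixes h :: "nat \<Rightarrow> nat \<Rightarrow> real" and \<sigma> :: real
  assumes k: "1 \<le> k" "k \<le> n"
    and weak: "\<And>\<alpha> \<beta>. finite \<alpha> \<Longrightarrow> card \<alpha> = k \<Longrightarrow> \<beta> \<subseteq> {0..<n} \<Longrightarrow> card \<beta> = k \<Longrightarrow>
      0 \<le> \<sigma> * minor h (sorted_elems \<alpha>) (sorted_elems \<beta>)"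
    and strict: "\<And>\<alpha> \<beta>. finite \<alpha> \<Longrightarrow> card \<alpha> = k \<Longrightarrow> \<beta> \<subseteq> {0..<n} \<Longrightarrow> card \<beta> = k \<Longrightarrow> 0 \<in> \<beta> \<Longrightarrow>
      0 < \<sigma> * minor h (sorted_elems \<alpha>) (sorted_elems \<beta>)"
  shows "variation_bounding n (k - 1) (\<lambda>u i. \<Sum>l<n. h i l * u $ l)"
  unfolding variation_bounding_def
proof (intro ballI impI)
  fix u :: "real vec"
  assume u: "u \<in> carrier_vec n" "u \<noteq> 0\<^sub>v n" and var: "variation {..<n} (($) u) \<le> ereal (real (k - 1))"
  define y where "y = (\<lambda>i. \<Sum>l<n. h i l * u $ l)"
  have "variation UNIV y \<le> ereal (real (k - 1))"
  proof (rule ccontr)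
    assume "\<not> variation UNIV y \<le> ereal (real (k - 1))"
    then obtain f where f_mono: "\<And>m. m < k \<Longrightarrow> f m < f (Suc m)"
      and f_alt: "\<And>m. m < k \<Longrightarrow> y (f m) * y (f (Suc m)) < 0"
      using alternating_chain k(1) by blast
    have "\<exists>i<n. u $ i \<noteq> 0" using u by (metis carrier_vecD eq_vecI index_zero_vec)
    then obtain s where s: "\<And>i. i < n \<Longrightarrow> \<bar>s i\<bar> = 1" "\<And>i. i < n \<Longrightarrow> 0 \<le> u $ i * s i"
      "card {i. Suc i < n \<and> s i \<noteq> s (Suc i)} \<le> k - 1"
      using exists_sign_pattern[OF var] by blast
    obtain b \<tau> where b: "mono b" "b 0 = 0" "b ` {0..<n} = {0..<k}" "\<And>i. i < n \<Longrightarrow> s i = \<tau> (b i)"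
      using exists_blocks[OF k s(3)] by blast
    define z where "z = (\<lambda>i. \<Sum>l<n. h i l * s l)"
    have f_nz: "y (f m) \<noteq> 0" if "m \<le> k" for m
    proof (cases m)
      case 0
      then show ?thesis using f_alt[of 0] k(1) by auto
    next
      case (Suc m')
      then show ?thesis using f_alt[of m'] that by auto
    qed
    have "\<forall>\<^sub>F \<epsilon> in at_right 0. \<forall>m\<in>{..k}. 0 < (y (f m) + \<epsilon> * z (f m)) * y (f m)"
    proof (intro eventually_ball_finite ballI)
      fix m assume "m \<in> {..k}"
      then have "0 < (y (f m) + 0 * z (f m)) * y (f m)"
        using f_nz[of m] by (auto simp: zero_less_mult_iff linorder_neq_iff)
      moreover have "((\<lambda>\<epsilon>. (y (f m) + \<epsilon> * z (f m)) * y (f m)) \<longlongrightarrow>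
          (y (f m) + 0 * z (f m)) * y (f m)) (at_right 0)"
        by (intro tendsto_intros)
      ultimately show "\<forall>\<^sub>F \<epsilon> in at_right 0. 0 < (y (f m) + \<epsilon> * z (f m)) * y (f m)"
        by (rule order_tendstoD(1)[rotated])
    qed simp
    moreover have "\<forall>\<^sub>F \<epsilon> in at_right 0. (0 :: real) < \<epsilon>"
      by (rule eventually_at_right_less)
    ultimately have "\<forall>\<^sub>F \<epsilon> in at_right 0. 0 < \<epsilon> \<and> (\<forall>m\<in>{..k}. 0 < (y (f m) + \<epsilon> * z (f m)) * y (f m))"
      by eventually_elim simp
    \<comment> \<open>Adding \<open>\<epsilon> s\<close> to \<open>u\<close> removes the zeros of \<open>u\<close> and keeps the signs of \<open>y\<close> at the chosen rows.\<close>
    then obtain \<epsilon> where \<epsilon>: "0 < \<epsilon>" "\<And>m. m \<le> k \<Longrightarrow> 0 < (y (f m) + \<epsilon> * z (f m)) * y (f m)"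
      using eventually_happens'[OF trivial_limit_at_right_real] by blast
    define w where "w = (\<lambda>l. (u $ l + \<epsilon> * s l) * s l)"
    have s_sq: "s l * s l = 1" if "l < n" for l using s(1)[OF that] by (auto simp: abs_if split: if_splits)
    have w: "0 < w l" if "l < n" for l
    proof -
      have "w l = u $ l * s l + \<epsilon> * (s l * s l)" by (simp add: w_def algebra_simps)
      then show ?thesis using s(2)[OF that] s_sq[OF that] \<epsilon>(1) by simp
    qed
    define W where "W = (\<lambda>l j. if b l = j then w l else 0)"
    define V where "V = (\<lambda>i j. \<Sum>l<n. h i l * W l j)"
    have V_pos: "0 < \<sigma> * minor V (sorted_elems \<alpha>) [0..<k]" if \<alpha>: "finite \<alpha>" "card \<alpha> = k" for \<alpha>
    proof -
      let ?G = "{\<gamma>. \<gamma> \<subseteq> {0..<n} \<and> card \<gamma> = k}"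
      let ?t = "\<lambda>\<gamma>. \<sigma> * minor h (sorted_elems \<alpha>) (sorted_elems \<gamma>) * minor W (sorted_elems \<gamma>) [0..<k]"
      obtain g where g: "\<And>j. j < k \<Longrightarrow> g j < n \<and> b (g j) = j"
      proof -
        have "\<exists>i. i < n \<and> b i = j" if "j < k" for j
          using b(3) that by (metis atLeastLessThan_iff image_iff zero_le)
        then show ?thesis using that by metis
      qed
      \<comment> \<open>Block \<open>0\<close> is represented by its first element, so that \<open>0 \<in> \<gamma>\<close>.\<close>
      define \<gamma> where "\<gamma> = insert 0 (g ` {1..<k})"
      have b\<gamma>: "b ` \<gamma> = {0..<k}"
      proof -
        have "b ` g ` {1..<k} = {1..<k}" using g by (force simp: image_image)
        then show ?thesis using b(2) k(1) by (auto simp: \<gamma>_def)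
      qed
      have "card \<gamma> \<le> k" 
      proof -
        have "card \<gamma> \<le> Suc (card (g ` {1..<k}))" unfolding \<gamma>_def by (rule card_insert_le_m1) auto
        also have "\<dots> \<le> Suc (k - 1)" using card_image_le[of "{1..<k}" g] by simp
        finally show ?thesis using k(1) by simp
      qed
      moreover have "k \<le> card \<gamma>"
        using card_image_le[of \<gamma> b] b\<gamma> by (simp add: \<gamma>_def)
      ultimately have \<gamma>: "\<gamma> \<subseteq> {0..<n}" "card \<gamma> = k" "0 \<in> \<gamma>"
        using g k by (auto simp: \<gamma>_def)
      have "0 < (\<Sum>\<gamma>\<in>?G. ?t \<gamma>)"
      proof (rule sum_pos2[of _ \<gamma>])
        have "0 < minor W (sorted_elems \<gamma>) [0..<k]"
          unfolding W_def by (rule minor_block_weights(2)[OF b(1) \<gamma>(1,2) w b\<gamma>])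
        then show "0 < ?t \<gamma>" by (rule mult_pos_pos[OF strict[OF \<alpha> \<gamma>]])
        fix \<delta> assume "\<delta> \<in> ?G"
        then have \<delta>: "\<delta> \<subseteq> {0..<n}" "card \<delta> = k" by auto
        have "0 \<le> minor W (sorted_elems \<delta>) [0..<k]"
          unfolding W_def by (rule minor_block_weights(1)[OF b(1) \<delta> w])
        then show "0 \<le> ?t \<delta>" by (rule mult_nonneg_nonneg[OF weak[OF \<alpha> \<delta>]])
      qed (use \<gamma> in auto)
      also have "(\<Sum>\<gamma>\<in>?G. ?t \<gamma>) = \<sigma> * minor V (sorted_elems \<alpha>) [0..<k]"
        unfolding V_def using \<alpha> by (subst Cauchy_Binet[where k = k]) (auto simp: sum_distrib_left mult.assoc)
      finally show ?thesis .
    qed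
    define y' where "y' = (\<lambda>i. y i + \<epsilon> * z i)"
    have y'_sign: "0 < y' (f m) * y (f m)" if "m \<le> k" for m
      using \<epsilon>(2)[OF that] by (simp add: y'_def)
    have y'_V: "y' i = (\<Sum>j<k. V i j * \<tau> j)" for i
    proof -
      have "(\<Sum>j<k. V i j * \<tau> j) = (\<Sum>l<n. \<Sum>j<k. h i l * W l j * \<tau> j)"
        unfolding V_def sum_distrib_right by (rule sum.swap)
      also have "\<dots> = (\<Sum>l<n. h i l * (u $ l + \<epsilon> * s l))"
      proof (rule sum.cong[OF refl])
        fix l assume "l \<in> {..<n}"
        then have l: "l < n" by simp
        have "b l < k" using b(3) l by (metis atLeastLessThan_iff imageI zero_le)
        have "(\<Sum>j<k. h i l * W l j * \<tau> j) = (\<Sum>j<k. if j = b l then h i l * w l * s l else 0)"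
          by (rule sum.cong) (use b(4)[OF l] in \<open>auto simp: W_def\<close>)
        also have "\<dots> = h i l * (w l * s l)" using \<open>b l < k\<close> by simp
        also have "w l * s l = u $ l + \<epsilon> * s l"
          using s_sq[OF l] by (simp add: w_def mult.assoc)
        finally show "(\<Sum>j<k. h i l * W l j * \<tau> j) = h i l * (u $ l + \<epsilon> * s l)" .
      qed
      also have "\<dots> = y' i"
        by (simp add: y'_def y_def z_def algebra_simps sum.distrib sum_distrib_left)
      finally show ?thesis by simp
    qed
    define rs where "rs = map f [0..<Suc k]"
    define R where "R = (\<lambda>i. take i rs @ drop (Suc i) rs)"
    have len: "length rs = Suc k" by (simp add: rs_def)
    have rs_nth: "rs ! i = f i" if "i \<le> k" for i
      using that unfolding rs_def by (simp only: nth_map_upt less_Suc_eq_le diff_zero add_0)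
    have "sorted_wrt (<) rs"
      unfolding sorted_wrt_iff_nth_Suc_transp[OF transp_on_less] using f_mono rs_nth len by auto
    then have rs_less: "rs ! a < rs ! c" if "a < c" "c < length rs" for a c
      using that by (simp add: sorted_wrt_iff_nth_less)
    have R_sorted: "sorted_wrt (<) (R i)" for i
      unfolding R_def sorted_wrt_iff_nth_less
      by (auto simp: nth_append intro!: rs_less)
    have M_pos: "0 < \<sigma> * minor V (R i) [0..<k]" if "i \<le> k" for i
    proof -
      have "length (R i) = k" using that len by (simp add: R_def)
      moreover have "sorted (R i)" "distinct (R i)"
        using R_sorted[of i] by (auto simp: strict_sorted_iff)
      ultimately have "sorted_elems (set (R i)) = R i" "card (set (R i)) = k"
        by (auto simp: sorted_list_of_set.idem_if_sorted_distinct distinct_card)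
      then show ?thesis using V_pos[of "set (R i)"] by simp
    qed
    have alt': "0 < (- 1) ^ i * y' (f i) * y' (f 0)" if "i \<le> k" for i
      using that
    proof (induction i)
      case 0
      then show ?case using y'_sign[of 0] by (auto simp: zero_less_mult_iff)
    next
      case (Suc i)
      have "y' (f i) * y' (f (Suc i)) < 0"
        using y'_sign[of i] y'_sign[of "Suc i"] f_alt[of i] Suc.prems
        by (auto simp: zero_less_mult_iff mult_less_0_iff)
      then show ?case using Suc by (auto simp: zero_less_mult_iff mult_less_0_iff)
    qed
    have "(\<Sum>i<Suc k. (- 1) ^ i * y' (f i) * minor V (R i) [0..<k]) =
        (\<Sum>i<Suc k. \<Sum>j<k. \<tau> j * ((- 1) ^ i * V (rs ! i) ([0..<k] ! j) * minor V (R i) [0..<k]))"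
      unfolding y'_V sum_distrib_left sum_distrib_right
      by (intro sum.cong refl) (simp add: rs_nth less_Suc_eq_le ac_simps)
    also have "\<dots> = (\<Sum>j<k. \<tau> j * (\<Sum>i<length rs. (- 1) ^ i * V (rs ! i) ([0..<k] ! j) * minor V (R i) [0..<k]))"
      unfolding sum_distrib_left len by (rule sum.swap)
    also have "\<dots> = 0"
    proof (intro sum.neutral ballI)
      fix j assume "j \<in> {..<k}"
      then have "(\<Sum>i<length rs. (- 1) ^ i * V (rs ! i) ([0..<k] ! j) * minor V (R i) [0..<k]) = 0"
        unfolding R_def by (intro minor_laplace_relation) (use len in auto)
      then show "\<tau> j * (\<Sum>i<length rs. (- 1) ^ i * V (rs ! i) ([0..<k] ! j) * minor V (R i) [0..<k]) = 0"
        by (simp only: mult_zero_right)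
    qed
    finally have zero: "(\<Sum>i<Suc k. (- 1) ^ i * y' (f i) * minor V (R i) [0..<k]) = 0" .
    \<comment> \<open>The common factor \<open>\<sigma> y' (f 0)\<close> makes all terms of the vanishing sum positive.\<close>
    have "0 < (\<Sum>i<Suc k. ((- 1) ^ i * y' (f i) * y' (f 0)) * (\<sigma> * minor V (R i) [0..<k]))"
      by (intro sum_pos mult_pos_pos alt' M_pos) auto
    also have "\<dots> = y' (f 0) * \<sigma> * (\<Sum>i<Suc k. (- 1) ^ i * y' (f i) * minor V (R i) [0..<k])"
      unfolding sum_distrib_left by (intro sum.cong refl) (simp only: ac_simps)
    also have "\<dots> = 0" unfolding zero by (rule mult_zero_right)
    finally show False by simp
  qed
  then show "variation UNIV (\<lambda>i. \<Sum>l<n. h i l * u $ l) \<le> ereal (real (k - 1))"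
    unfolding y_def .
qed

section \<open>Submatrices and compound matrices in terms of minors\<close>

lemma pick_eq_nth:
  assumes "finite I" "i < card I"
  shows "pick I i = sorted_elems I ! i"
proof -
  have "sorted_wrt (<) (map (pick I) [0..<card I])"
    by (auto simp: sorted_wrt_iff_nth_less intro: pick_mono_le)
  then have sd: "sorted (map (pick I) [0..<card I])" "distinct (map (pick I) [0..<card I])"
    by (simp_all add: strict_sorted_iff)
  have "set (map (pick I) [0..<card I]) = I"
    by (rule card_subset_eq[OF assms(1)]) (use distinct_card[OF sd(2)] in \<open>auto intro: pick_in_set_le\<close>)
  then have "map (pick I) [0..<card I] = sorted_elems I"
    by (intro sorted_distinct_set_unique) (use sd assms in auto)
  then show ?thesis using assms(2) by (metis add_0 diff_zero length_upt nth_map nth_upt)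
qed

lemma minor_cong:
  assumes "\<And>i j. i \<in> set rs \<Longrightarrow> j \<in> set cs \<Longrightarrow> X i j = Y i j"
  shows "minor X rs cs = minor Y rs cs"
  unfolding minor_def by (intro arg_cong[where f = det] eq_matI) (auto intro: assms)

lemma minor_map:
  "minor X (map f rs) (map g cs) = minor (\<lambda>i j. X (f i) (g j)) rs cs"
  unfolding minor_def by (intro arg_cong[where f = det] eq_matI) auto

lemma finite_vimage_Suc: "finite \<alpha> \<Longrightarrow> finite (Suc -` \<alpha>)"
  by (rule finite_vimageI) auto

lemma det_submat:
  assumes "\<alpha> \<subseteq> {1..dim_row X}" "\<beta> \<subseteq> {1..dim_col X}"
  shows "det (submat X \<alpha> \<beta>) = minor (\<lambda>i j. X $$ (i, j)) (sorted_elems (Suc -` \<alpha>)) (sorted_elems (Suc -` \<beta>))"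
proof -
  have *: "{i. i < m \<and> i \<in> Suc -` \<gamma>} = Suc -` \<gamma>" "finite (Suc -` \<gamma>)" if "\<gamma> \<subseteq> {1..m}" for m \<gamma>
    using that finite_vimage_Suc[of \<gamma>] finite_subset[of \<gamma>] by auto
  show ?thesis
    unfolding submat_def submatrix_def minor_def *(1)[OF assms(1)] *(1)[OF assms(2)] length_sorted_list_of_set
    by (intro arg_cong[where f = det] eq_matI) (auto simp: pick_eq_nth *(2)[OF assms(1)] *(2)[OF assms(2)])
qed

lemma bij_betw_vimage_Suc:
  "bij_betw (\<lambda>\<alpha>. Suc -` \<alpha>) (index_sets n k) {\<gamma>. \<gamma> \<subseteq> {0..<n} \<and> card \<gamma> = k}"
proof (rule bij_betw_byWitness[where f' = "(`) Suc"])
  have inv: "Suc ` (Suc -` \<alpha>) = \<alpha>" if "\<alpha> \<in> index_sets n k" for \<alpha>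
  proof -
    have "\<alpha> \<subseteq> range Suc"
    proof
      fix x assume "x \<in> \<alpha>"
      then have "x = Suc (x - 1)" using that by (auto simp: index_sets_def)
      then show "x \<in> range Suc" by (rule range_eqI)
    qed
    then show ?thesis by (auto simp: image_vimage_eq)
  qed
  then show "\<forall>\<alpha>\<in>index_sets n k. Suc ` (Suc -` \<alpha>) = \<alpha>" by blast
  show "\<forall>\<gamma>\<in>{\<gamma>. \<gamma> \<subseteq> {0..<n} \<and> card \<gamma> = k}. Suc -` Suc ` \<gamma> = \<gamma>" by (auto simp: inj_vimage_image_eq)
  show "(\<lambda>\<alpha>. Suc -` \<alpha>) ` index_sets n k \<subseteq> {\<gamma>. \<gamma> \<subseteq> {0..<n} \<and> card \<gamma> = k}"
  proof clarify
    fix \<alpha> assume \<alpha>: "\<alpha> \<in> index_sets n k"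
    have "card (Suc -` \<alpha>) = card (Suc ` (Suc -` \<alpha>))"
      by (rule card_image[symmetric]) simp
    then have "card (Suc -` \<alpha>) = k" using inv[OF \<alpha>] \<alpha> by (simp add: index_sets_def)
    then show "Suc -` \<alpha> \<subseteq> {0..<n} \<and> card (Suc -` \<alpha>) = k" using \<alpha> by (auto simp: index_sets_def)
  qed
  show "(`) Suc ` {\<gamma>. \<gamma> \<subseteq> {0..<n} \<and> card \<gamma> = k} \<subseteq> index_sets n k"
    by (auto simp: index_sets_def card_image)
qed

abbreviation nth_index_set :: "nat \<Rightarrow> nat \<Rightarrow> nat \<Rightarrow> nat set" where
  "nth_index_set n k i \<equiv> Suc -` (index_list n k ! i)"

lemma card_index_sets: "card (index_sets n k) = n choose k"
  using n_subsets[of "{1..n}" k] by (simp add: index_sets_def)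

lemma sum_nth_index_set:
  "(\<Sum>i<n choose k. g (nth_index_set n k i)) = (\<Sum>\<gamma> | \<gamma> \<subseteq> {0..<n} \<and> card \<gamma> = k. g \<gamma>)"
proof -
  have "distinct (index_list n k)"
    by (rule card_distinct) (simp add: set_index_list length_index_list card_index_sets)
  then have "bij_betw (\<lambda>i. index_list n k ! i) {..<n choose k} (index_sets n k)"
    by (intro bij_betw_nth) (simp_all add: length_index_list set_index_list)
  from bij_betw_trans[OF this bij_betw_vimage_Suc]
  have "bij_betw (\<lambda>i. nth_index_set n k i) {..<n choose k} {\<gamma>. \<gamma> \<subseteq> {0..<n} \<and> card \<gamma> = k}"
    by (simp add: comp_def)
  then show ?thesis by (rule sum.reindex_bij_betw)
qed

lemma nth_index_set:
  assumes "i < n choose k"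
  shows "nth_index_set n k i \<subseteq> {0..<n}" "card (nth_index_set n k i) = k"
    "index_list n k ! i \<in> index_sets n k"
proof -
  show *: "index_list n k ! i \<in> index_sets n k"
    using nth_mem[of i "index_list n k"] assms by (simp add: length_index_list set_index_list)
  show "nth_index_set n k i \<subseteq> {0..<n}" "card (nth_index_set n k i) = k"
    using bij_betwE[OF bij_betw_vimage_Suc[of n k]] * by auto
qed

lemma nth_index_set_full: "nth_index_set k k 0 = {0..<k}"
  using nth_index_set[of 0 k k] by (intro card_subset_eq) auto

lemma compound_index:
  assumes "i < dim_row X choose r" "j < dim_col X choose r"
  shows "compound r X $$ (i, j) = minor (\<lambda>i j. X $$ (i, j))
    (sorted_elems (nth_index_set (dim_row X) r i)) (sorted_elems (nth_index_set (dim_col X) r j))"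
  using assms nth_index_set(3)[of i "dim_row X" r] nth_index_set(3)[of j "dim_col X" r]
  by (simp add: compound_def det_submat index_sets_def)

lemma compound_mult:
  assumes X: "X \<in> carrier_mat p q" and Y: "Y \<in> carrier_mat q s"
  shows "compound r (X * Y) = compound r X * compound r Y"
proof (rule eq_matI)
  fix i j assume "i < dim_row (compound r X * compound r Y)" "j < dim_col (compound r X * compound r Y)"
  then have ij: "i < p choose r" "j < s choose r" using X Y by (auto simp: compound_def)
  note I = nth_index_set[OF ij(1)] and J = nth_index_set[OF ij(2)]
  let ?I = "sorted_elems (nth_index_set p r i)" and ?J = "sorted_elems (nth_index_set s r j)"
  let ?x = "\<lambda>i j. X $$ (i, j)" and ?y = "\<lambda>i j. Y $$ (i, j)"
  have fin: "finite (nth_index_set p r i)" "finite (nth_index_set s r j)"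
    using I(1) J(1) finite_subset by blast+
  have "compound r (X * Y) $$ (i, j) = minor (\<lambda>i j. (X * Y) $$ (i, j)) ?I ?J"
    using X Y ij by (simp add: compound_index)
  also have "\<dots> = minor (\<lambda>i j. \<Sum>l<q. ?x i l * ?y l j) ?I ?J"
    using I(1) J(1) fin X Y
    by (intro minor_cong) (auto simp: scalar_prod_def atLeast0LessThan subset_eq)
  also have "\<dots> = (\<Sum>\<gamma> | \<gamma> \<subseteq> {0..<q} \<and> card \<gamma> = r. minor ?x ?I (sorted_elems \<gamma>) * minor ?y (sorted_elems \<gamma>) ?J)"
    by (rule Cauchy_Binet) (use I(2) J(2) in auto)
  also have "\<dots> = (\<Sum>l<q choose r. minor ?x ?I (sorted_elems (nth_index_set q r l)) *
      minor ?y (sorted_elems (nth_index_set q r l)) ?J)"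
    by (rule sum_nth_index_set[symmetric])
  also have "\<dots> = (\<Sum>l<q choose r. compound r X $$ (i, l) * compound r Y $$ (l, j))"
    using X Y ij by (intro sum.cong refl) (simp add: compound_index)
  also have "\<dots> = (compound r X * compound r Y) $$ (i, j)"
    using X Y ij by (simp add: scalar_prod_def atLeast0LessThan compound_def)
  finally show "compound r (X * Y) $$ (i, j) = (compound r X * compound r Y) $$ (i, j)" .
qed (simp_all add: compound_def)

lemma compound_dim [simp]:
  "dim_row (compound r X) = dim_row X choose r" "dim_col (compound r X) = dim_col X choose r"
  by (simp_all add: compound_def)

lemma compound_carrier: "X \<in> carrier_mat p q \<Longrightarrow> compound r X \<in> carrier_mat (p choose r) (q choose r)"
  by auto

text \<open>Stated with a left factor \<open>X\<close>, since this avoids computing the compound of an identity matrix.\<close>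

lemma compound_mult_pow:
  assumes X: "X \<in> carrier_mat p n" and A: "A \<in> carrier_mat n n"
  shows "compound r X * compound r A ^\<^sub>m t = compound r (X * A ^\<^sub>m t)"
proof (induction t)
  case 0
  then show ?case using X A compound_carrier[OF X, of r] by simp
next
  case (Suc t)
  note c = compound_carrier[OF X, of r] compound_carrier[OF A, of r]
  have "compound r X * compound r A ^\<^sub>m Suc t = compound r X * compound r A ^\<^sub>m t * compound r A"
    using c by (simp add: assoc_mult_mat[OF c(1) pow_carrier_mat[OF c(2)] c(2)])
  also have "\<dots> = compound r (X * A ^\<^sub>m t * A)"
    unfolding Suc.IH using X A by (intro compound_mult[symmetric, of _ p n _ n]) auto
  also have "X * A ^\<^sub>m t * A = X * A ^\<^sub>m Suc t"
    using X A by (simp add: assoc_mult_mat[of X p n "A ^\<^sub>m t" n A n])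
  finally show ?case .
qed

section \<open>The lexicographic position of the index sets containing an initial segment\<close>

text \<open>At the first position where \<open>u\<close> differs from \<open>[Suc a..<Suc a + s]\<close> its entry is larger, because a
strictly increasing list above \<open>a\<close> dominates the consecutive one.\<close>

lemma upt_append_lex_less:
  fixes u :: "nat list"
  assumes "sorted_wrt (<) u" "\<forall>x\<in>set u. a < x" "s \<le> length u" "take s u \<noteq> [Suc a..<Suc a + s]"
  shows "[Suc a..<Suc a + s] @ v < u"
  using assms
proof (induction s arbitrary: a u)
  case (Suc s)
  then obtain x u' where u: "u = x # u'" by (cases u) auto
  have upt: "[Suc a..<Suc a + Suc s] = Suc a # [Suc (Suc a)..<Suc (Suc a) + s]"
    by (subst upt_conv_Cons) auto
  show ?case
  proof (cases "x = Suc a")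
    case True
    have "[Suc (Suc a)..<Suc (Suc a) + s] @ v < u'"
      using Suc.prems unfolding u upt True by (intro Suc.IH) auto
    then show ?thesis unfolding u upt True by simp
  next
    case False
    then have "Suc a < x" using Suc.prems(2) u by auto
    then show ?thesis unfolding u upt by simp
  qed
qed simp

lemma append_less_append_iff: "(p @ xs < p @ ys) = (xs < (ys :: nat list))"
  by (induction p) auto

lemma map_plus_less_iff: "(map ((+) s) xs < map ((+) s) ys) = (xs < (ys :: nat list))"
proof (induction xs arbitrary: ys)
  case Nil
  then show ?case by (cases ys) auto
next
  case (Cons x xs)
  then show ?case by (cases ys) auto
qed

text \<open>The injection from \<open>r\<close>-subsets of \<open>{1..n - s}\<close> to the subsets of \<open>{1..n}\<close> of size \<open>s + r\<close> that contain \<open>{1..s}\<close>.\<close>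

definition extend_index_set :: "nat \<Rightarrow> nat set \<Rightarrow> nat set" where
  "extend_index_set s J = {1..s} \<union> (+) s ` J"

lemma sorted_elems_extend:
  assumes "finite J" "0 \<notin> J"
  shows "sorted_elems (extend_index_set s J) = [1..<Suc s] @ map ((+) s) (sorted_elems J)"
proof (rule sorted_distinct_set_unique)
  have "sorted (map ((+) s) (sorted_elems J))"
    by (rule sorted_map_mono) (auto simp: mono_on_def)
  then show "sorted ([1..<Suc s] @ map ((+) s) (sorted_elems J))"
    using assms by (auto simp: sorted_append simp del: upt_Suc)
  show "distinct ([1..<Suc s] @ map ((+) s) (sorted_elems J))"
    using assms by (auto simp: distinct_map simp del: upt_Suc intro: gr0I)
qed (use assms in \<open>auto simp: extend_index_set_def simp del: upt_Suc\<close>)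

text \<open>On sorted lists, \<open>extend_index_set\<close> adds a common prefix and shifts all entries, so it preserves the
lexicographic order. A set that does not contain \<open>{1..s}\<close> comes later by \<open>upt_append_lex_less\<close>. Hence
column \<open>i\<close> of the \<open>r\<close>-th compound of a matrix with \<open>n - s\<close> columns and entry \<open>i\<close> of a \<open>k\<close>-th compound
vector belong together for \<open>i\<close> below \<open>(n - s) choose r\<close>.\<close>

lemma index_list_split:
  assumes "r \<le> k" "k \<le> n"
  defines "s \<equiv> k - r"
  obtains us where "index_list n k = map (extend_index_set s) (index_list (n - s) r) @ us"
    "\<And>I. I \<in> set us \<Longrightarrow> \<not> {1..s} \<subseteq> I"
proof -
  let ?S = "index_sets n k" and ?J = "index_sets (n - s) r"
  let ?U = "{I \<in> ?S. \<not> {1..s} \<subseteq> I}"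
  have fin: "finite I" if "I \<in> index_sets m l" for I m l
    using that finite_subset by (auto simp: index_sets_def)
  have J0: "0 \<notin> J" if "J \<in> ?J" for J using that by (auto simp: index_sets_def)
  have S_eq: "?S = extend_index_set s ` ?J \<union> ?U"
  proof
    have "I \<in> extend_index_set s ` ?J" if I: "I \<in> ?S" "{1..s} \<subseteq> I" for I
    proof
      let ?K = "(\<lambda>x. x - s) ` (I - {1..s})"
      have gt: "s < x" if "x \<in> I - {1..s}" for x using I(1) that by (auto simp: index_sets_def)
      have "(+) s ` ?K = I - {1..s}"
        unfolding image_image using gt by (force simp: image_iff)
      then show "I = extend_index_set s ?K" using I(2) by (auto simp: extend_index_set_def)
      have "inj_on (\<lambda>x. x - s) (I - {1..s})"
        using gt by (intro inj_onI) (metis le_add_diff_inverse less_imp_le_nat)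
      then have "card ?K = card I - s"
        using I fin[OF I(1)] by (simp add: card_image card_Diff_subset)
      moreover have "?K \<subseteq> {1..n - s}" using I(1) gt by (force simp: index_sets_def)
      ultimately show "?K \<in> ?J" using I(1) assms by (auto simp: index_sets_def)
    qed
    then show "?S \<subseteq> extend_index_set s ` ?J \<union> ?U" by blast
    have "extend_index_set s J \<in> ?S" if "J \<in> ?J" for J
    proof -
      have "card (extend_index_set s J) = s + card J"
        using that fin[OF that] J0[OF that] unfolding extend_index_set_def
        by (subst card_Un_disjoint) (auto simp: card_image intro: gr0I)
      moreover have "extend_index_set s J \<subseteq> {1..n}"
        using that assms unfolding extend_index_set_def index_sets_def by force
      ultimately show ?thesis using that assms by (simp add: index_sets_def)
    qed
    then show "extend_index_set s ` ?J \<union> ?U \<subseteq> ?S" by blast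
  qed
  let ?f = "\<lambda>xs. [1..<Suc s] @ map ((+) s) xs"
  let ?LJ = "sorted_list_of_set (sorted_elems ` ?J)" and ?LU = "sorted_list_of_set (sorted_elems ` ?U)"
  have finJ: "finite ?J" and finU: "finite ?U" using finite_index_sets by auto
  have f_image: "?f ` sorted_elems ` ?J = sorted_elems ` extend_index_set s ` ?J"
    unfolding image_image by (rule image_cong[OF refl]) (use fin J0 sorted_elems_extend in auto)
  have less_U: "?f xs < sorted_elems I" if "I \<in> ?U" for xs I
  proof -
    have I: "I \<in> ?S" "\<not> {1..s} \<subseteq> I" and "finite I" using that fin by auto
    have "[Suc 0..<Suc 0 + s] @ map ((+) s) xs < sorted_elems I"
    proof (rule upt_append_lex_less)
      show "\<forall>x\<in>set (sorted_elems I). 0 < x" using I(1) \<open>finite I\<close> by (force simp: index_sets_def)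
      show "s \<le> length (sorted_elems I)" using I(1) assms by (simp add: index_sets_def)
      show "take s (sorted_elems I) \<noteq> [Suc 0..<Suc 0 + s]"
      proof
        assume "take s (sorted_elems I) = [Suc 0..<Suc 0 + s]"
        then have "set [Suc 0..<Suc 0 + s] \<subseteq> set (sorted_elems I)" by (metis set_take_subset)
        then show False using I(2) \<open>finite I\<close> by (auto simp: subset_eq)
      qed
    qed simp
    then show ?thesis by simp
  qed
  have "sorted_list_of_set (sorted_elems ` ?S) = map ?f ?LJ @ ?LU"
  proof (rule sorted_distinct_set_unique)
    have "sorted_wrt (<) ?LJ" by simp
    then have "sorted_wrt (<) (map ?f ?LJ)"
      by (simp add: sorted_wrt_map append_less_append_iff map_plus_less_iff del: upt_Suc)
    then have "sorted_wrt (<) (map ?f ?LJ @ ?LU)"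
      unfolding sorted_wrt_append using finJ finU less_U by (auto simp del: upt_Suc)
    then show "sorted (map ?f ?LJ @ ?LU)" "distinct (map ?f ?LJ @ ?LU)"
      by (simp_all only: strict_sorted_iff)
    have "set (map ?f ?LJ @ ?LU) = ?f ` sorted_elems ` ?J \<union> sorted_elems ` ?U"
      using finJ finU by (simp del: upt_Suc)
    also have "\<dots> = sorted_elems ` ?S"
      unfolding f_image S_eq[symmetric] image_Un[symmetric] ..
    finally show "set (sorted_list_of_set (sorted_elems ` ?S)) = set (map ?f ?LJ @ ?LU)"
      using finite_index_sets by simp
  qed simp_all
  then have "index_list n k = map set (map ?f ?LJ) @ map set ?LU"
    unfolding index_list_def by simp
  moreover have "map set (map ?f ?LJ) = map (extend_index_set s) (index_list (n - s) r)"
    unfolding index_list_def by (auto simp: extend_index_set_def simp del: upt_Suc)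
  ultimately show ?thesis
    by (intro that[of "map set ?LU"]) (use finU fin in auto)
qed

section \<open>Minors of the observability matrix as impulse responses\<close>

lemma minor_zero_row:
  assumes "length rs = length cs" "a \<in> set rs" "\<And>l. l \<in> set cs \<Longrightarrow> X a l = 0"
  shows "minor X rs cs = 0"
proof -
  obtain i where i: "i < length rs" "rs ! i = a" using assms(2) by (auto simp: in_set_conv_nth)
  let ?M = "mat (length rs) (length cs) (\<lambda>(i, j). X (rs ! i) (cs ! j))"
  have "det ?M = (\<Sum>j<length rs. ?M $$ (i, j) * cofactor ?M i j)"
    by (rule laplace_expansion_row) (use assms(1) i(1) in auto)
  also have "\<dots> = 0"
    by (intro sum.neutral ballI) (use i assms in auto)
  finally show ?thesis unfolding minor_def .
qed

lemma minor_identity_block: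
  fixes Z :: "nat \<Rightarrow> nat \<Rightarrow> 'a :: idom"
  assumes "length rs = length cs" "\<And>l. l \<in> set cs \<Longrightarrow> s \<le> l"
    and Z: "\<And>a l. a < s \<Longrightarrow> l \<in> {0..<s} \<union> set cs \<Longrightarrow> Z a l = (if a = l then 1 else 0)"
  shows "minor Z ([0..<s] @ rs) ([0..<s] @ cs) = minor Z rs cs"
proof -
  let ?r = "length cs"
  let ?A3 = "mat ?r s (\<lambda>(i, j). Z (rs ! i) j)" and ?A4 = "mat ?r ?r (\<lambda>(i, j). Z (rs ! i) (cs ! j))"
  let ?F = "four_block_mat (1\<^sub>m s) (0\<^sub>m s ?r) ?A3 ?A4"
  have "mat (s + ?r) (s + ?r) (\<lambda>(i, j). Z (([0..<s] @ rs) ! i) (([0..<s] @ cs) ! j)) = ?F"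
  proof (rule eq_matI)
    fix i j assume "i < dim_row ?F" "j < dim_col ?F"
    then have ij: "i < s + ?r" "j < s + ?r" by auto
    have "cs ! (j - s) \<in> set cs" if "\<not> j < s" using ij that by (intro nth_mem) auto
    then have "Z i (cs ! (j - s)) = 0" if "i < s" "\<not> j < s"
      using Z[of i "cs ! (j - s)"] assms(2)[of "cs ! (j - s)"] that by auto
    then show "mat (s + ?r) (s + ?r) (\<lambda>(i, j). Z (([0..<s] @ rs) ! i) (([0..<s] @ cs) ! j)) $$ (i, j) =
        ?F $$ (i, j)"
      using ij Z[of i j] by (auto simp: nth_append)
  qed auto
  then have "minor Z ([0..<s] @ rs) ([0..<s] @ cs) = det ?F"
    using assms(1) by (simp add: minor_def)
  also have "\<dots> = det (1\<^sub>m s) * det ?A4"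
    by (rule det_four_block_mat_upper_right_zero) auto
  finally show ?thesis using assms(1) by (simp add: minor_def)
qed

lemma pow_mat_add:
  assumes "A \<in> carrier_mat n n"
  shows "A ^\<^sub>m (i + t) = A ^\<^sub>m i * A ^\<^sub>m t"
proof (induction t)
  case 0
  then show ?case using assms by simp
next
  case (Suc t)
  then show ?case
    using assms by (simp add: assoc_mult_mat[of _ n n _ n A n])
qed

text \<open>The entries of the observability matrix with infinitely many rows, of which every \<open>obs_mat A c N\<close> is a
truncation.\<close>

definition obs_entry :: "real mat \<Rightarrow> real mat \<Rightarrow> nat \<Rightarrow> nat \<Rightarrow> real" where
  "obs_entry A c i j = (c * A ^\<^sub>m i) $$ (0, j)"

lemma mult_mat_index_sum:
  assumes "X \<in> carrier_mat p q" "Y \<in> carrier_mat q s" "i < p" "j < s"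
  shows "(X * Y) $$ (i, j) = (\<Sum>l<q. X $$ (i, l) * Y $$ (l, j))"
  using assms by (auto simp: scalar_prod_def atLeast0LessThan)

lemma sorted_elems_vimage_extend:
  assumes "finite J" "0 \<notin> J"
  shows "sorted_elems (Suc -` extend_index_set s J) = [0..<s] @ map ((+) s) (sorted_elems (Suc -` J))"
proof (rule sorted_distinct_set_unique)
  have fin: "finite (Suc -` J)" using assms(1) by (rule finite_vimage_Suc)
  have "sorted (map ((+) s) (sorted_elems (Suc -` J)))"
    by (rule sorted_map_mono) (auto simp: mono_on_def)
  then show "sorted ([0..<s] @ map ((+) s) (sorted_elems (Suc -` J)))"
    using fin by (auto simp: sorted_append)
  show "distinct ([0..<s] @ map ((+) s) (sorted_elems (Suc -` J)))"
    using fin by (auto simp: distinct_map)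
  have "Suc -` extend_index_set s J = {0..<s} \<union> (+) s ` (Suc -` J)"
  proof (rule Set.set_eqI)
    fix x
    have "(\<exists>y\<in>J. Suc x = s + y) \<longleftrightarrow> (\<exists>y. Suc y \<in> J \<and> x = s + y)"
    proof
      assume "\<exists>y\<in>J. Suc x = s + y"
      then obtain y where "y \<in> J" "Suc x = s + y" by blast
      moreover obtain y' where "y = Suc y'" using \<open>y \<in> J\<close> assms(2) by (cases y) auto
      ultimately show "\<exists>y. Suc y \<in> J \<and> x = s + y" by auto
    qed auto
    then show "x \<in> Suc -` extend_index_set s J \<longleftrightarrow> x \<in> {0..<s} \<union> (+) s ` (Suc -` J)"
      by (auto simp: extend_index_set_def)
  qed
  moreover have "finite (Suc -` extend_index_set s J)"
    by (rule finite_vimage_Suc) (use assms in \<open>simp add: extend_index_set_def\<close>)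
  ultimately show "set (sorted_elems (Suc -` extend_index_set s J)) =
      set ([0..<s] @ map ((+) s) (sorted_elems (Suc -` J)))"
    using fin by simp
qed simp_all

context
  fixes A c :: "real mat" and n :: nat
  assumes A: "A \<in> carrier_mat n n" and c: "c \<in> carrier_mat 1 n"
begin

lemma obs_mat_carrier: "obs_mat A c N \<in> carrier_mat N n"
  using A by (simp add: obs_mat_def)

lemma obs_mat_index: "i < N \<Longrightarrow> j < n \<Longrightarrow> obs_mat A c N $$ (i, j) = obs_entry A c i j"
  using A by (simp add: obs_mat_def obs_entry_def)

lemma obs_entry_add:
  assumes "j < n"
  shows "obs_entry A c (i + t) j = (\<Sum>l<n. obs_entry A c i l * (A ^\<^sub>m t) $$ (l, j))"
proof -
  have "c * A ^\<^sub>m (i + t) = c * A ^\<^sub>m i * A ^\<^sub>m t"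
    unfolding pow_mat_add[OF A] by (rule assoc_mult_mat[symmetric, of _ 1 n _ n _ n]) (use A c in auto)
  then show ?thesis
    unfolding obs_entry_def
    using mult_mat_index_sum[of "c * A ^\<^sub>m i" 1 n "A ^\<^sub>m t" n 0 j] A c assms by simp
qed

lemma obs_op_eq_sum:
  assumes "x \<in> carrier_vec n"
  shows "obs_op A c x i = (\<Sum>l<n. obs_entry A c i l * x $ l)"
  unfolding obs_op_def obs_entry_def using A c assms
  by (auto simp: mult_mat_vec_def scalar_prod_def atLeast0LessThan)

lemma observable_inverse:
  assumes "observable A c"
  obtains V where "mat_inverse (obs_mat A c n) = Some V" "V \<in> carrier_mat n n"
    "obs_mat A c n * V = 1\<^sub>m n" "V * obs_mat A c n = 1\<^sub>m n"
proof -
  let ?O = "obs_mat A c n"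
  have O: "?O \<in> carrier_mat n n" by (rule obs_mat_carrier)
  have "invertible_mat ?O" using assms A by (simp add: observable_def)
  then obtain B where B: "?O * B = 1\<^sub>m (dim_row ?O)" "B * ?O = 1\<^sub>m (dim_row B)"
    unfolding invertible_mat_def inverts_mat_def by blast
  have "dim_row B = dim_col ?O" using arg_cong[OF B(2), of dim_col] by simp
  moreover have "dim_col B = dim_row ?O" using arg_cong[OF B(1), of dim_col] by simp
  ultimately have "B \<in> carrier_mat n n" using O by auto
  then have "?O \<in> Units (ring_mat TYPE(real) n ())"
    using O B unfolding Units_def by (auto simp: ring_mat_simps intro!: bexI[of _ B])
  then obtain V where V: "mat_inverse ?O = Some V"
    using mat_inverse(1)[OF O, of "()"] by (cases "mat_inverse ?O") auto
  show ?thesis using that[OF V] mat_inverse(2)[OF O V] by blast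
qed

text \<open>The function \<open>Z\<close> contains the coordinates of the rows of \<open>O\<close> with respect to the rows of \<open>O\<^sup>n\<close>. Both sides
are expanded into sums over the positions \<open>i\<close> of \<open>index_list n k\<close>, with a factor from the
minors of \<open>Z\<close> and a factor from the input vector, and are compared term by term.\<close>

theorem impulse_response_eq_minor:
  assumes obs: "observable A c" and r: "1 \<le> r" "r \<le> k" and k: "k \<le> n"
    and \<beta>: "\<beta> \<in> index_sets n k" and t: "1 \<le> t"
  shows "impulse_response (sys_A A r) (sys_b A c k r \<beta>) (sys_c A c r) t =
    minor (obs_entry A c) ([0..<k - r] @ [k - r + t - 1..<k + t - 1]) (sorted_elems (Suc -` \<beta>))"
proof -
  define s m p where "s = k - r" and "m = n - s" and "p = t - 1 + s"
  have sm: "s + m = n" "n - k + r = m" "k = s + r" "s \<le> n" using r k by (auto simp: s_def m_def)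
  let ?h = "obs_entry A c" and ?bs = "sorted_elems (Suc -` \<beta>)"
  let ?On = "obs_mat A c n" and ?Or = "obs_mat A c r"
  note On = obs_mat_carrier[of n] and Or = obs_mat_carrier[of r]
  obtain V where V: "mat_inverse ?On = Some V" "V \<in> carrier_mat n n"
    and V_inv: "?On * V = 1\<^sub>m n" "V * ?On = 1\<^sub>m n"
    using observable_inverse[OF obs] by blast
  have \<beta>_img: "Suc -` \<beta> \<subseteq> {0..<n}" "card (Suc -` \<beta>) = k"
    using bij_betwE[OF bij_betw_vimage_Suc[of n k]] \<beta> by auto
  have fin\<beta>: "finite (Suc -` \<beta>)" using \<beta>_img(1) finite_subset by blast
  have bs: "length ?bs = k" "\<And>j. j < k \<Longrightarrow> ?bs ! j < n"
  proof -
    show len: "length ?bs = k" using \<beta>_img(2) by simp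
    fix j assume "j < k"
    then have "?bs ! j \<in> set ?bs" using len by (intro nth_mem) simp
    then show "?bs ! j < n" using \<beta>_img(1) fin\<beta> by auto
  qed

  define Z where "Z = (\<lambda>i l. \<Sum>j<n. ?h i j * V $$ (j, l))"
  have Z_one: "Z a l = (if a = l then 1 else 0)" if "a < n" "l < n" for a l
  proof -
    have "Z a l = (?On * V) $$ (a, l)"
      unfolding mult_mat_index_sum[OF On V(2) that] using that by (simp add: Z_def obs_mat_index)
    then show ?thesis using that V_inv(1) by simp
  qed
  have h_Z: "?h a b = (\<Sum>l<n. Z a l * ?h l b)" if "b < n" for a b
  proof -
    have "(\<Sum>l<n. Z a l * ?h l b) = (\<Sum>j<n. \<Sum>l<n. ?h a j * V $$ (j, l) * ?h l b)"
      unfolding Z_def sum_distrib_right by (rule sum.swap)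
    also have "\<dots> = (\<Sum>j<n. ?h a j * (V * ?On) $$ (j, b))"
    proof (rule sum.cong[OF refl])
      fix j assume "j \<in> {..<n}"
      then have "(V * ?On) $$ (j, b) = (\<Sum>l<n. V $$ (j, l) * ?h l b)"
        using that by (subst mult_mat_index_sum[OF V(2) On]) (auto simp: obs_mat_index)
      then show "(\<Sum>l<n. ?h a j * V $$ (j, l) * ?h l b) = ?h a j * (V * ?On) $$ (j, b)"
        by (simp only: sum_distrib_left mult.assoc)
    qed
    also have "\<dots> = (\<Sum>j<n. if j = b then ?h a j else 0)"
      unfolding V_inv by (intro sum.cong refl) (use that in auto)
    also have "\<dots> = ?h a b" using that by simp
    finally show ?thesis by simp
  qed

  let ?rows = "[0..<s] @ [p..<p + r]"
  have "minor ?h ?rows ?bs = minor (\<lambda>i j. \<Sum>l<n. Z i l * ?h l j) ?rows ?bs"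
    using \<beta>_img(1) fin\<beta> by (intro minor_cong) (auto simp: h_Z subset_eq)
  also have "\<dots> = (\<Sum>\<gamma> | \<gamma> \<subseteq> {0..<n} \<and> card \<gamma> = k. minor Z ?rows (sorted_elems \<gamma>) * minor ?h (sorted_elems \<gamma>) ?bs)"
    by (rule Cauchy_Binet) (use bs sm in auto)
  also have "\<dots> = (\<Sum>i<n choose k. minor Z ?rows (sorted_elems (nth_index_set n k i)) *
      minor ?h (sorted_elems (nth_index_set n k i)) ?bs)"
    by (rule sum_nth_index_set[symmetric])
  finally have lhs: "minor ?h ?rows ?bs = \<dots>" .

  define E :: "real mat" where "E = 0\<^sub>m s m @\<^sub>r 1\<^sub>m m"
  define B where "B = A ^\<^sub>m s * V * E"
  have E: "E \<in> carrier_mat n m"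
    unfolding E_def using sm carrier_append_rows[of "0\<^sub>m s m" s m "1\<^sub>m m" m] by auto
  have E_index: "E $$ (j, l) = (if j = s + l then 1 else 0)" if "j < n" "l < m" for j l
    using that sm unfolding E_def append_rows_def by auto
  have B: "B \<in> carrier_mat n m" using A V(2) E unfolding B_def by auto
  have ORA: "(?Or * A ^\<^sub>m q) $$ (a, j) = ?h (a + q) j" if "a < r" "j < n" for q a j
    unfolding mult_mat_index_sum[OF Or pow_carrier_mat[OF A] that] obs_entry_add[OF that(2)]
    by (intro sum.cong refl) (use that in \<open>simp add: obs_mat_index\<close>)
  have OB: "(?Or * A ^\<^sub>m (t - 1) * B) $$ (a, l) = Z (a + p) (s + l)" if al: "a < r" "l < m" for a l
  proof -
    have *: "?Or * A ^\<^sub>m p \<in> carrier_mat r n" "?Or * A ^\<^sub>m p * V \<in> carrier_mat r n"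
      using Or A V(2) by auto
    have "?Or * A ^\<^sub>m (t - 1) * B = ?Or * A ^\<^sub>m (t - 1) * (A ^\<^sub>m s * V) * E"
      unfolding B_def by (rule assoc_mult_mat[symmetric, of _ r n _ n _ m]) (use Or A V(2) E in auto)
    also have "?Or * A ^\<^sub>m (t - 1) * (A ^\<^sub>m s * V) = ?Or * A ^\<^sub>m (t - 1) * A ^\<^sub>m s * V"
      by (rule assoc_mult_mat[symmetric, of _ r n _ n _ n]) (use Or A V(2) in auto)
    also have "?Or * A ^\<^sub>m (t - 1) * A ^\<^sub>m s = ?Or * A ^\<^sub>m p"
      unfolding p_def pow_mat_add[OF A] by (rule assoc_mult_mat[of _ r n _ n _ n]) (use Or A in auto)
    finally have "(?Or * A ^\<^sub>m (t - 1) * B) $$ (a, l) =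
        (\<Sum>j<n. (?Or * A ^\<^sub>m p * V) $$ (a, j) * E $$ (j, l))"
      using mult_mat_index_sum[OF *(2) E al] by simp
    also have "\<dots> = (\<Sum>j<n. if j = s + l then (?Or * A ^\<^sub>m p * V) $$ (a, j) else 0)"
      by (intro sum.cong refl) (use al in \<open>simp add: E_index\<close>)
    also have "\<dots> = (?Or * A ^\<^sub>m p * V) $$ (a, s + l)" using al sm by simp
    also have "\<dots> = Z (a + p) (s + l)"
      unfolding Z_def using al sm by (subst mult_mat_index_sum[OF *(1) V(2)]) (simp_all add: ORA)
    finally show ?thesis .
  qed

  define K where "K = append_cols (compound r B) (0\<^sub>m (n choose r) ((n choose k) - (m choose r)))"
  define d where "d = compound k (?On * P_mat n \<beta>)"
  define L where "L = compound r (?Or * A ^\<^sub>m (t - 1))"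
  have choose_le: "m choose r \<le> n choose k"
  proof -
    have "m choose r = m choose (n - k)" using sm k by (metis add_diff_cancel_right' binomial_symmetric le_add2)
    also have "\<dots> \<le> n choose (n - k)" using sm by (intro binomial_right_mono) auto
    also have "\<dots> = n choose k" using k by (simp add: binomial_symmetric[symmetric])
    finally show ?thesis .
  qed
  have K: "K \<in> carrier_mat (n choose r) (n choose k)"
    using B choose_le unfolding K_def append_cols_def carrier_mat_def by auto
  have P_dims: "{i. i < n \<and> i \<in> Suc -` {1..n}} = {0..<n}" "{j. j < n \<and> j \<in> Suc -` \<beta>} = Suc -` \<beta>"
    "Suc -` {1..n} = {0..<n}"
    using \<beta>_img(1) by auto
  have P: "P_mat n \<beta> \<in> carrier_mat n k"
    unfolding P_mat_def submat_def
    by (rule carrier_matI)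
      (simp_all only: dim_submatrix index_one_mat P_dims(1,2) card_atLeastLessThan diff_zero \<beta>_img(2))
  have d: "d \<in> carrier_mat (n choose k) 1"
    unfolding d_def using On P by auto
  have L: "L \<in> carrier_mat 1 (n choose r)"
    unfolding L_def using Or A by auto
  have P_index: "P_mat n \<beta> $$ (l, j) = (if l = ?bs ! j then 1 else 0)" if "l < n" "j < k" for l j
  proof -
    have "P_mat n \<beta> $$ (l, j) = 1\<^sub>m n $$ (pick {0..<n} l, pick (Suc -` \<beta>) j)"
      unfolding P_mat_def submat_def P_dims(3)[symmetric]
      by (rule submatrix_index)
        (simp_all only: index_one_mat P_dims(1,2) card_atLeastLessThan diff_zero \<beta>_img(2) that)
    also have "pick {0..<n} l = l" using that(1) by (simp add: pick_eq_nth)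
    also have "pick (Suc -` \<beta>) j = ?bs ! j" by (rule pick_eq_nth) (use fin\<beta> \<beta>_img(2) that(2) in auto)
    finally show ?thesis using that(1) bs(2)[OF that(2)] by simp
  qed
  have d_index: "d $$ (i, 0) = minor ?h (sorted_elems (nth_index_set n k i)) ?bs" if "i < n choose k" for i
  proof -
    note I = nth_index_set[OF that]
    have fin: "finite (nth_index_set n k i)" using I(1) finite_subset by blast
    have "d $$ (i, 0) = minor (\<lambda>i j. (?On * P_mat n \<beta>) $$ (i, j)) (sorted_elems (nth_index_set n k i)) [0..<k]"
      unfolding d_def using that On P by (simp add: compound_index nth_index_set_full)
    also have "\<dots> = minor (\<lambda>i j. ?h i (?bs ! j)) (sorted_elems (nth_index_set n k i)) [0..<k]"
    proof (rule minor_cong)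
      fix i' j assume "i' \<in> set (sorted_elems (nth_index_set n k i))" "j \<in> set [0..<k]"
      then have ij: "i' < n" "j < k" using I(1) fin by auto
      have "(?On * P_mat n \<beta>) $$ (i', j) = (\<Sum>l<n. ?h i' l * (if l = ?bs ! j then 1 else 0))"
        unfolding mult_mat_index_sum[OF On P ij]
        by (intro sum.cong refl) (use ij in \<open>simp add: obs_mat_index P_index\<close>)
      also have "\<dots> = (\<Sum>l<n. if l = ?bs ! j then ?h i' l else 0)" by (intro sum.cong refl) auto
      also have "\<dots> = ?h i' (?bs ! j)" using bs(2)[OF ij(2)] by simp
      finally show "(?On * P_mat n \<beta>) $$ (i', j) = ?h i' (?bs ! j)" .
    qed
    also have "\<dots> = minor ?h (map id (sorted_elems (nth_index_set n k i))) (map ((!) ?bs) [0..<k])"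
      by (simp only: minor_map id_apply)
    also have "map ((!) ?bs) [0..<k] = ?bs" using map_nth[of ?bs] bs(1) by simp
    finally show ?thesis by simp
  qed
  obtain us where us: "index_list n k = map (extend_index_set s) (index_list m r) @ us"
      "\<And>I. I \<in> set us \<Longrightarrow> \<not> {1..s} \<subseteq> I"
    using index_list_split[OF r(2) k] unfolding s_def[symmetric] m_def[symmetric] by blast
  have LK_index: "(L * K) $$ (0, i) = minor Z ?rows (sorted_elems (nth_index_set n k i))"
    if i: "i < n choose k" for i
  proof (cases "i < m choose r")
    case True
    note J = nth_index_set[OF True]
    let ?js = "sorted_elems (nth_index_set m r i)"
    have finJ: "finite (nth_index_set m r i)" using J(1) finite_subset by blast
    have K_index: "K $$ (j, i) = compound r B $$ (j, i)" if "j < n choose r" for j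
      using that True B i unfolding K_def append_cols_def by auto
    have "(L * K) $$ (0, i) = (\<Sum>j<n choose r. L $$ (0, j) * compound r B $$ (j, i))"
      using mult_mat_index_sum[OF L K _ i, of 0] K_index by simp
    also have "\<dots> = (L * compound r B) $$ (0, i)"
      using mult_mat_index_sum[OF L compound_carrier[OF B, of r] _ True, of 0] by simp
    also have "L * compound r B = compound r (?Or * A ^\<^sub>m (t - 1) * B)"
      unfolding L_def by (rule compound_mult[symmetric, of _ r n _ m]) (use Or A B in auto)
    also have "\<dots> $$ (0, i) = minor (\<lambda>a l. (?Or * A ^\<^sub>m (t - 1) * B) $$ (a, l)) [0..<r] ?js"
      using True Or A B by (simp add: compound_index nth_index_set_full)
    also have "\<dots> = minor (\<lambda>a l. Z (a + p) (s + l)) [0..<r] ?js"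
    proof (rule minor_cong)
      fix a l assume "a \<in> set [0..<r]" "l \<in> set ?js"
      then have "a < r" "l < m" using J(1) finJ by auto
      then show "(?Or * A ^\<^sub>m (t - 1) * B) $$ (a, l) = Z (a + p) (s + l)" by (rule OB)
    qed
    also have "\<dots> = minor Z (map (\<lambda>a. a + p) [0..<r]) (map ((+) s) ?js)"
      by (rule minor_map[symmetric])
    also have "map (\<lambda>a. a + p) [0..<r] = [p..<p + r]"
      by (simp add: map_add_upt add.commute)
    also have "minor Z [p..<p + r] (map ((+) s) ?js) = minor Z ?rows ([0..<s] @ map ((+) s) ?js)"
      using J finJ sm by (intro minor_identity_block[symmetric] Z_one) (auto simp: subset_eq)
    also have "[0..<s] @ map ((+) s) ?js = sorted_elems (nth_index_set n k i)"
    proof -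
      have "index_list n k ! i = extend_index_set s (index_list m r ! i)"
        using True by (simp add: us(1) nth_append length_index_list)
      moreover have "finite (index_list m r ! i)" "0 \<notin> index_list m r ! i"
        using J(3) finite_subset by (auto simp: index_sets_def)
      ultimately show ?thesis by (simp add: sorted_elems_vimage_extend)
    qed
    finally show ?thesis .
  next
    case False
    have "K $$ (j, i) = 0" if "j < n choose r" for j
      using that False B i unfolding K_def append_cols_def by auto
    then have "(L * K) $$ (0, i) = 0"
      using mult_mat_index_sum[OF L K _ i, of 0] by simp
    moreover have "minor Z ?rows (sorted_elems (nth_index_set n k i)) = 0"
    proof -
      note I = nth_index_set[OF i]
      have fin: "finite (nth_index_set n k i)" using I(1) finite_subset by blast
      have "i < length (index_list n k)" using i by (simp add: length_index_list)
      then have "index_list n k ! i \<in> set us"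
        using False unfolding us(1) by (auto simp: nth_append length_index_list)
      then obtain x where "x \<in> {1..s}" "x \<notin> index_list n k ! i" using us(2) by blast
      then have a: "x - 1 < s" "x - 1 \<notin> nth_index_set n k i" by auto
      show ?thesis
      proof (rule minor_zero_row[of _ _ "x - 1"])
        fix l assume "l \<in> set (sorted_elems (nth_index_set n k i))"
        then have "l < n" "l \<noteq> x - 1" using I(1) fin a by auto
        then show "Z (x - 1) l = 0" using a(1) sm by (subst Z_one) auto
      qed (use a(1) I(2) sm in auto)
    qed
    ultimately show ?thesis by simp
  qed

  have "sys_b A c k r \<beta> = K * d"
    unfolding sys_b_def Let_def K_def d_def B_def E_def using A V(1) sm(2) by (simp add: s_def)
  then have "impulse_response (sys_A A r) (sys_b A c k r \<beta>) (sys_c A c r) t = (L * (K * d)) $$ (0, 0)"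
    unfolding impulse_response_def sys_A_def sys_c_def L_def compound_mult_pow[OF Or A] by simp
  also have "L * (K * d) = L * K * d"
    by (rule assoc_mult_mat[symmetric, OF L K d])
  also have "(L * K * d) $$ (0, 0) = (\<Sum>i<n choose k. (L * K) $$ (0, i) * d $$ (i, 0))"
    by (rule mult_mat_index_sum) (use L K d in auto)
  also have "\<dots> = minor ?h ?rows ?bs"
    unfolding lhs by (intro sum.cong refl) (simp add: LK_index d_index)
  also have "?rows = [0..<k - r] @ [k - r + t - 1..<k + t - 1]"
    unfolding s_def
    by (intro arg_cong2[where f = "(@)"] arg_cong2[where f = upt] refl)
      (use t r in \<open>simp_all add: s_def p_def\<close>)
  finally show ?thesis .
qed

lemma sorted_elems_initial_set:
  assumes "k' \<le> i"
  shows "sorted_elems ({0..<k'} \<union> {i..<i + r}) = [0..<k'] @ [i..<i + r]"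
  by (rule sorted_distinct_set_unique) (use assms in \<open>auto simp: sorted_append\<close>)

lemma vimage_Suc_initial_set:
  assumes "1 \<le> t"
  shows "Suc -` ({1..k'} \<union> {t..t + r - 1}) = {0..<k'} \<union> {t - 1..<t - 1 + r}"
  using assms by auto

lemma det_obs_mat_eq_impulse_response:
  assumes obs: "observable A c" and r: "1 \<le> r" "r \<le> k" and k: "k \<le> n"
    and \<beta>: "\<beta> \<in> index_sets n k" and t: "1 \<le> t" "t + k \<le> N + 1"
  shows "det (submat (obs_mat A c N) ({1..k - r} \<union> {k - r + t..k + t - 1}) \<beta>) =
    impulse_response (sys_A A r) (sys_b A c k r \<beta>) (sys_c A c r) t"
proof -
  let ?\<alpha> = "{1..k - r} \<union> {k - r + t..k + t - 1}"
  have \<alpha>: "?\<alpha> \<subseteq> {1..N}" using t r by auto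
  have shift: "k + t - 1 = k - r + t + r - 1" "k - r + t - 1 + r = k + t - 1" using r t by simp_all
  have "Suc -` ?\<alpha> = {0..<k - r} \<union> {k - r + t - 1..<k - r + t - 1 + r}"
    unfolding shift(1) by (rule vimage_Suc_initial_set) (use t in simp)
  also have "sorted_elems \<dots> = [0..<k - r] @ [k - r + t - 1..<k - r + t - 1 + r]"
    by (rule sorted_elems_initial_set) (use t in simp)
  finally have rows: "sorted_elems (Suc -` ?\<alpha>) = [0..<k - r] @ [k - r + t - 1..<k + t - 1]"
    unfolding shift(2) .
  have \<beta>_img: "Suc -` \<beta> \<subseteq> {0..<n}" "\<beta> \<subseteq> {1..n}"
    using bij_betwE[OF bij_betw_vimage_Suc[of n k]] \<beta> by (auto simp: index_sets_def)
  then have "finite (Suc -` \<beta>)" using finite_subset by blast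
  have "det (submat (obs_mat A c N) ?\<alpha> \<beta>) = minor (\<lambda>i j. obs_mat A c N $$ (i, j))
      (sorted_elems (Suc -` ?\<alpha>)) (sorted_elems (Suc -` \<beta>))"
    by (rule det_submat) (use obs_mat_carrier[of N] \<alpha> \<beta>_img in auto)
  also have "\<dots> = minor (obs_entry A c) (sorted_elems (Suc -` ?\<alpha>)) (sorted_elems (Suc -` \<beta>))"
    unfolding rows using \<beta>_img \<open>finite (Suc -` \<beta>)\<close> t r
    by (intro minor_cong) (auto simp: obs_mat_index subset_eq)
  finally show ?thesis
    unfolding rows using impulse_response_eq_minor[OF obs r k \<beta> t(1)] by simp
qed

text \<open>Column sets are parametrised as in the hypothesis of the theorem below: \<open>r' < k \<or> t' = 1\<close> says that
\<open>1\<close> belongs to the set.\<close>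

lemma variation_bounding_from_impulse_responses:
  fixes \<sigma> :: real
  assumes obs: "observable A c" and k: "1 \<le> k" "k \<le> n"
  defines "g \<equiv> \<lambda>r r' t'. impulse_response (sys_A A r)
      (sys_b A c k r ({1..k - r'} \<union> {t'..t' + r' - 1})) (sys_c A c r)"
  assumes weak: "\<And>r r' t' t. \<lbrakk>r \<in> {1..k}; r' \<in> {1..k}; t' \<in> {k - r' + 1..n - r' + 1}; 1 \<le> t\<rbrakk> \<Longrightarrow>
      0 \<le> \<sigma> * g r r' t' t"
    and strict: "\<And>r r' t' t. \<lbrakk>r \<in> {1..k}; r' \<in> {1..k}; t' \<in> {k - r' + 1..n - r' + 1}; 1 \<le> t;
      r' < k \<or> t' = 1\<rbrakk> \<Longrightarrow> 0 < \<sigma> * g r r' t' t"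
  shows "variation_bounding n (k - 1) (obs_op A c)"
proof -
  let ?h = "obs_entry A c"
  have g: "g r r' (j + 1) (i - (k - r) + 1) = minor ?h (sorted_elems ({0..<k - r} \<union> {i..<i + r}))
      (sorted_elems ({0..<k - r'} \<union> {j..<j + r'}))"
    if "r \<in> {1..k}" "k - r \<le> i" "r' \<in> {1..k}" "k - r' \<le> j" "j + r' \<le> n" for r i r' j
  proof -
    let ?\<beta> = "{1..k - r'} \<union> {j + 1..j + 1 + r' - 1}"
    have "card ?\<beta> = k" using that by (subst card_Un_disjoint) auto
    then have "?\<beta> \<in> index_sets n k" using that k by (auto simp: index_sets_def)
    then have "g r r' (j + 1) (i - (k - r) + 1) =
        minor ?h ([0..<k - r] @ [i..<i + r]) (sorted_elems (Suc -` ?\<beta>))"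
      unfolding g_def using impulse_response_eq_minor[OF obs _ _ k(2), of r ?\<beta> "i - (k - r) + 1"] that
      by simp
    also have "Suc -` ?\<beta> = {0..<k - r'} \<union> {j..<j + r'}"
      using vimage_Suc_initial_set[of "j + 1" "k - r'" r'] by simp
    finally show ?thesis using sorted_elems_initial_set that(2) by simp
  qed
  have w: "0 \<le> \<sigma> * minor ?h (sorted_elems ({0..<k - r} \<union> {i..<i + r}))
      (sorted_elems ({0..<k - r'} \<union> {j..<j + r'}))"
    if "r \<in> {1..k}" "k - r \<le> i" "r' \<in> {1..k}" "k - r' \<le> j" "j + r' \<le> n" for r i r' j
    using weak[of r r' "j + 1" "i - (k - r) + 1"] that unfolding g[OF that] by auto
  have s: "0 < \<sigma> * minor ?h (sorted_elems ({0..<k - r} \<union> {i..<i + r}))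
      (sorted_elems ({0..<k - r'} \<union> {j..<j + r'}))"
    if "r \<in> {1..k}" "k - r \<le> i" "r' \<in> {1..k}" "k - r' \<le> j" "j + r' \<le> n" "r' < k \<or> j = 0" for r i r' j
    using strict[of r r' "j + 1" "i - (k - r) + 1"] that unfolding g[OF that(1-5)] by auto
  have "variation_bounding n (k - 1) (\<lambda>u i. \<Sum>l<n. ?h i l * u $ l)"
  proof (rule variation_bounding_from_minors[OF k, where \<sigma> = \<sigma>])
    fix \<alpha> \<beta> :: "nat set"
    assume *: "finite \<alpha>" "card \<alpha> = k" "\<beta> \<subseteq> {0..<n}" "card \<beta> = k"
    show "0 \<le> \<sigma> * minor ?h (sorted_elems \<alpha>) (sorted_elems \<beta>)"
      by (rule minors_nonneg_from_initial_minors(2)[OF k w s *])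
    assume "0 \<in> \<beta>"
    from minors_nonneg_from_initial_minors(1)[OF k w s * this]
    show "0 < \<sigma> * minor ?h (sorted_elems \<alpha>) (sorted_elems \<beta>)" .
  qed
  then show ?thesis
    unfolding variation_bounding_def
  proof (intro ballI impI)
    fix u :: "real vec"
    assume u: "u \<in> carrier_vec n" "u \<noteq> 0\<^sub>v n" "variation {..<n} (($) u) \<le> ereal (real (k - 1))"
      and *: "\<forall>u\<in>carrier_vec n. u \<noteq> 0\<^sub>v n \<longrightarrow> variation {..<n} (($) u) \<le> ereal (real (k - 1)) \<longrightarrow>
        variation UNIV (\<lambda>i. \<Sum>l<n. ?h i l * u $ l) \<le> ereal (real (k - 1))"
    have "obs_op A c u = (\<lambda>i. \<Sum>l<n. ?h i l * u $ l)"
      using obs_op_eq_sum[OF u(1)] by blast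
    then show "variation UNIV (obs_op A c u) \<le> ereal (real (k - 1))" using * u by simp
  qed
qed

end

theorem proposition13:
  fixes A c :: "real mat" and n k :: nat
  assumes A: "A \<in> carrier_mat n n"
    and c: "c \<in> carrier_mat 1 n"
    and obs: "observable A c"
    and k: "k \<in> {1..n}"
  shows
    "(\<forall>r\<in>{1..k}. \<forall>\<beta>\<in>index_sets n k. \<forall>N\<ge>1. \<forall>t\<ge>1. t + k \<le> N + 1 \<longrightarrow>
        (let \<alpha> = {1..k - r} \<union> {k - r + t..k + t - 1} in
          det (submat (obs_mat A c N) \<alpha> \<beta>) =
          (sys_c A c r * sys_A A r ^\<^sub>m (t - 1) * sys_b A c k r \<beta>) $$ (0, 0)))
     \<and>
     ((\<forall>r\<in>{1..k}. \<forall>r'\<in>{1..k}. \<forall>t'\<in>{k - r' + 1..n - r' + 1}.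
         let \<beta> = {1..k - r'} \<union> {t'..t' + r' - 1} in
         if r' = k \<and> t' \<in> {k + 1..n - k + 1}
         then externally_positive (sys_A A r) (sys_b A c k r \<beta>) (sys_c A c r) \<and>
              (\<forall>l\<in>{1..k}. impulse_response (sys_A A r) (sys_b A c k r \<beta>) (sys_c A c r) l \<noteq> 0)
         else strictly_externally_positive (sys_A A r) (sys_b A c k r \<beta>) (sys_c A c r))
      \<longrightarrow> variation_bounding n (k - 1) (obs_op A c))
     \<and>
     ((\<forall>r\<in>{1..k}. \<forall>r'\<in>{1..k}. \<forall>t'\<in>{k - r' + 1..n - r' + 1}.
         let \<beta> = {1..k - r'} \<union> {t'..t' + r' - 1} in
         if r' = k \<and> t' \<in> {k + 1..n - k + 1}
         then externally_negative (sys_A A r) (sys_b A c k r \<beta>) (sys_c A c r) \<and>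
              (\<forall>l\<in>{1..k}. impulse_response (sys_A A r) (sys_b A c k r \<beta>) (sys_c A c r) l \<noteq> 0)
         else strictly_externally_negative (sys_A A r) (sys_b A c k r \<beta>) (sys_c A c r))
      \<longrightarrow> variation_bounding n (k - 1) (obs_op A c))"
proof (intro conjI impI)
  have k: "1 \<le> k" "k \<le> n" using k by auto
  show "\<forall>r\<in>{1..k}. \<forall>\<beta>\<in>index_sets n k. \<forall>N\<ge>1. \<forall>t\<ge>1. t + k \<le> N + 1 \<longrightarrow>
      (let \<alpha> = {1..k - r} \<union> {k - r + t..k + t - 1} in
        det (submat (obs_mat A c N) \<alpha> \<beta>) =
        (sys_c A c r * sys_A A r ^\<^sub>m (t - 1) * sys_b A c k r \<beta>) $$ (0, 0))"
    using det_obs_mat_eq_impulse_response[OF A c obs _ _ k(2)]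
    by (simp add: Let_def impulse_response_def)
  note bounding = variation_bounding_from_impulse_responses[OF A c obs k]
  let ?\<beta> = "\<lambda>r' t'. {1..k - r'} \<union> {t'..t' + r' - 1}"
  {
    assume signs: "\<forall>r\<in>{1..k}. \<forall>r'\<in>{1..k}. \<forall>t'\<in>{k - r' + 1..n - r' + 1}.
         let \<beta> = ?\<beta> r' t' in
         if r' = k \<and> t' \<in> {k + 1..n - k + 1}
         then externally_positive (sys_A A r) (sys_b A c k r \<beta>) (sys_c A c r) \<and>
              (\<forall>l\<in>{1..k}. impulse_response (sys_A A r) (sys_b A c k r \<beta>) (sys_c A c r) l \<noteq> 0)
         else strictly_externally_positive (sys_A A r) (sys_b A c k r \<beta>) (sys_c A c r)"
    have H: "if r' = k \<and> t' \<in> {k + 1..n - k + 1}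
        then externally_positive (sys_A A r) (sys_b A c k r (?\<beta> r' t')) (sys_c A c r)
        else strictly_externally_positive (sys_A A r) (sys_b A c k r (?\<beta> r' t')) (sys_c A c r)"
      if "r \<in> {1..k}" "r' \<in> {1..k}" "t' \<in> {k - r' + 1..n - r' + 1}" for r r' t'
      using bspec[OF bspec[OF bspec[OF signs that(1)] that(2)] that(3)]
      unfolding Let_def by (auto split: if_splits)
    show "variation_bounding n (k - 1) (obs_op A c)"
    proof (rule bounding[of 1])
      fix r r' t' t :: nat
      assume *: "r \<in> {1..k}" "r' \<in> {1..k}" "t' \<in> {k - r' + 1..n - r' + 1}" "1 \<le> t"
      show "0 \<le> 1 * impulse_response (sys_A A r) (sys_b A c k r (?\<beta> r' t')) (sys_c A c r) t"
        using H[OF *(1-3)] *(4)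
        by (auto simp: externally_positive_def strictly_externally_positive_def
            intro: less_imp_le split: if_splits)
      assume "r' < k \<or> t' = 1"
      then have "\<not> (r' = k \<and> t' \<in> {k + 1..n - k + 1})" using k by auto
      then show "0 < 1 * impulse_response (sys_A A r) (sys_b A c k r (?\<beta> r' t')) (sys_c A c r) t"
        using H[OF *(1-3)] *(4) by (simp only: if_False strictly_externally_positive_def mult_1)
    qed
  }
  {
    assume signs: "\<forall>r\<in>{1..k}. \<forall>r'\<in>{1..k}. \<forall>t'\<in>{k - r' + 1..n - r' + 1}.
         let \<beta> = ?\<beta> r' t' in
         if r' = k \<and> t' \<in> {k + 1..n - k + 1}
         then externally_negative (sys_A A r) (sys_b A c k r \<beta>) (sys_c A c r) \<and>
              (\<forall>l\<in>{1..k}. impulse_response (sys_A A r) (sys_b A c k r \<beta>) (sys_c A c r) l \<noteq> 0)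
         else strictly_externally_negative (sys_A A r) (sys_b A c k r \<beta>) (sys_c A c r)"
    have H: "if r' = k \<and> t' \<in> {k + 1..n - k + 1}
        then externally_negative (sys_A A r) (sys_b A c k r (?\<beta> r' t')) (sys_c A c r)
        else strictly_externally_negative (sys_A A r) (sys_b A c k r (?\<beta> r' t')) (sys_c A c r)"
      if "r \<in> {1..k}" "r' \<in> {1..k}" "t' \<in> {k - r' + 1..n - r' + 1}" for r r' t'
      using bspec[OF bspec[OF bspec[OF signs that(1)] that(2)] that(3)]
      unfolding Let_def by (auto split: if_splits)
    show "variation_bounding n (k - 1) (obs_op A c)"
    proof (rule bounding[of "- 1"])
      fix r r' t' t :: nat
      assume *: "r \<in> {1..k}" "r' \<in> {1..k}" "t' \<in> {k - r' + 1..n - r' + 1}" "1 \<le> t"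
      show "0 \<le> - 1 * impulse_response (sys_A A r) (sys_b A c k r (?\<beta> r' t')) (sys_c A c r) t"
        using H[OF *(1-3)] *(4)
        by (auto simp: externally_negative_def strictly_externally_negative_def
            intro: less_imp_le split: if_splits)
      assume "r' < k \<or> t' = 1"
      then have "\<not> (r' = k \<and> t' \<in> {k + 1..n - k + 1})" using k by auto
      then show "0 < - 1 * impulse_response (sys_A A r) (sys_b A c k r (?\<beta> r' t')) (sys_c A c r) t"
        using H[OF *(1-3)] *(4)
        by (simp only: if_False strictly_externally_negative_def mult_minus1 neg_0_less_iff_less)
    qed
  }
qed

end
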